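(* Let $\mathfrak{D}_p$ be the category of distributive lattices with quasi-proper lattice homomorphisms, and $\mathfrak{DoBD}$ the category whose objects are doubly Balbes-Dwinger spaces (pairwise Balbes-Dwinger spaces $(X,\tau,\sigma)$ with $\tau=\sigma$) and whose morphisms are morphisms of pairwise Balbes-Dwinger spaces. Then the functor $spec_B$, $L\mapsto (\mathfrak{M}(L),\tau_L,\sigma_L)$, $f\mapsto \big((I,F)\mapsto (f^{-1}(I),f^{-1}(F))\big)$, restricts to a duality (contravariant equivalence) $\mathfrak{D}_p\to\mathfrak{DoBD}$, whose quasi-inverse is $\mathfrak{E}$, $X\mapsto$ the lattice of essential subsets of $X$, $f\mapsto f^{-1}$.
   Context: Ideals and filters of a lattice are nonempty. A comaximal pair of a lattice $L$ is a pair $(I,F)$, $I$ an ideal, $F$ a filter, $I\cap F=\emptyset$, such that every ideal $J\supsetneq I$ meets $F$ and every filter $K\supsetneq F$ meets $I$; $\mathfrak{M}(L)$ is their set. $\delta_L(x)=\{(I,F)\in\mathfrak{M}(L): x\notin I\}$, $\epsilon_L(x)=\{(I,F): x\in F\}$; $\sigma_L$ is the topology with basis $\{\epsilon_L(x)\}$, $\tau_L$ the topology with subbasis $\{\delta_L(x)\}$. A lattice homomorphism $f:L\to N$ is quasi-proper if preimages of comaximal pairs of $N$ are comaximal pairs of $L$. For a topology $\rho$ on $X$, $x\sqsubseteq_\rho y$ means every $\rho$-open set containing $x$ contains $y$. For $(X,\tau,\sigma)$: $i(B)=\{x:\exists b\in B,\ b\sqsubseteq_\tau x\}$, $d(A)=\{x:\forall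 y\,(x\sqsubseteq_\sigma y\Rightarrow y\in A)\}$. $A$ is stable if $\sqsubseteq_\tau$-upward closed with $i(d(A))=A$. A nonempty $A$ is essential if $\tau$-compact, $d(A)$ $\sigma$-open and stable; $\emptyset$ is essential if every family of $\sigma$-compact $\sigma$-open sets with the finite intersection property has nonempty intersection. A pairwise Balbes-Dwinger space is $(X,\tau,\sigma)$ with: (i) pairwise $T_0$ (for $x\neq y$ there is a $\tau$-open set containing $x$ but not $y$, or a $\sigma$-open set containing $y$ but not $x$); (ii) essential sets form a subbasis of $\tau$; (iii) $\{d(A):A$ essential$\}$ is a basis of $\sigma$ closed under finite intersections; (iv) for essential $A,B$, $A\cup B$ and $i(d(A\cap B))$ are essential; (v) whenever nonempty families $V,W$ of essential sets satisfy $\bigcap_{A\in V}d(A)\subseteq\bigcup_{B\in W}B$, there are finite nonempty $V_1\subseteq V,W_1\subseteq W$ with $\bigcap_{A\in V_1}d(A)\subseteq\bigcup_{B\in W_1}B$. A morphism $f:X\to Y$ of such spaces is a map continuous for both topologies, with $f^{-1}(A)$ essential for essential $A$, and $f^{-1}(d_Y(A))=d_X(f^{-1}(A))$ and $f^{-1}(i_Y(d_Y(A)))=i_X(f^{-1}(d_Y(A)))$ for essential $A\subseteq Y$. *)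

theory Defs
  imports "HOL-Analysis.Analysis" "HOL-Algebra.Lattice"
begin

section \<open>Distributive lattices, ideals, filters, comaximal pairs\<close>

text \<open>
  The locale \<open>lattice\<close> of HOL-Algebra admits an empty carrier; as usual, lattices are
  taken to be nonempty here.
\<close>

definition distrib_lattice_obj :: "'a gorder \<Rightarrow> bool" where
  "distrib_lattice_obj L \<longleftrightarrow> lattice L \<and> carrier L \<noteq> {} \<and>
     (\<forall>x\<in>carrier L. \<forall>y\<in>carrier L. \<forall>z\<in>carrier L.
        x \<sqinter>\<^bsub>L\<^esub> (y \<squnion>\<^bsub>L\<^esub> z) = (x \<sqinter>\<^bsub>L\<^esub> y) \<squnion>\<^bsub>L\<^esub> (x \<sqinter>\<^bsub>L\<^esub> z))"

definition lat_ideal :: "'a gorder \<Rightarrow> 'a set \<Rightarrow> bool" where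
  "lat_ideal L I \<longleftrightarrow> I \<noteq> {} \<and> I \<subseteq> carrier L \<and>
     (\<forall>x\<in>I. \<forall>y\<in>carrier L. y \<sqsubseteq>\<^bsub>L\<^esub> x \<longrightarrow> y \<in> I) \<and>
     (\<forall>x\<in>I. \<forall>y\<in>I. x \<squnion>\<^bsub>L\<^esub> y \<in> I)"

definition lat_filter :: "'a gorder \<Rightarrow> 'a set \<Rightarrow> bool" where
  "lat_filter L F \<longleftrightarrow> F \<noteq> {} \<and> F \<subseteq> carrier L \<and>
     (\<forall>x\<in>F. \<forall>y\<in>carrier L. x \<sqsubseteq>\<^bsub>L\<^esub> y \<longrightarrow> y \<in> F) \<and>
     (\<forall>x\<in>F. \<forall>y\<in>F. x \<sqinter>\<^bsub>L\<^esub> y \<in> F)"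

definition comaximal_pairs :: "'a gorder \<Rightarrow> ('a set \<times> 'a set) set" where
  "comaximal_pairs L = {(I, F). lat_ideal L I \<and> lat_filter L F \<and> I \<inter> F = {} \<and>
     (\<forall>J. lat_ideal L J \<and> I \<subset> J \<longrightarrow> J \<inter> F \<noteq> {}) \<and>
     (\<forall>K. lat_filter L K \<and> F \<subset> K \<longrightarrow> K \<inter> I \<noteq> {})}"

definition lat_hom :: "'a gorder \<Rightarrow> 'b gorder \<Rightarrow> ('a \<Rightarrow> 'b) \<Rightarrow> bool" where
  "lat_hom L N f \<longleftrightarrow> f \<in> carrier L \<rightarrow> carrier N \<and>
     (\<forall>x\<in>carrier L. \<forall>y\<in>carrier L.
        f (x \<squnion>\<^bsub>L\<^esub> y) = f x \<squnion>\<^bsub>N\<^esub> f y \<and> f (x \<sqinter>\<^bsub>L\<^esub> y) = f x \<sqinter>\<^bsub>N\<^esub> f y)"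

definition quasi_proper :: "'a gorder \<Rightarrow> 'b gorder \<Rightarrow> ('a \<Rightarrow> 'b) \<Rightarrow> bool" where
  "quasi_proper L N f \<longleftrightarrow>
     (\<forall>(I, F)\<in>comaximal_pairs N.
        (f -` I \<inter> carrier L, f -` F \<inter> carrier L) \<in> comaximal_pairs L)"


section \<open>Bitopological spaces and pairwise Balbes-Dwinger spaces\<close>

record 'x bispace =
  tau :: "'x topology"
  sigma :: "'x topology"

abbreviation points :: "'x bispace \<Rightarrow> 'x set" where
  "points X \<equiv> topspace (tau X)"

definition spec_le :: "'x topology \<Rightarrow> 'x \<Rightarrow> 'x \<Rightarrow> bool" where
  "spec_le \<rho> x y \<longleftrightarrow> (\<forall>U. openin \<rho> U \<and> x \<in> U \<longrightarrow> y \<in> U)"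

definition i_op :: "'x bispace \<Rightarrow> 'x set \<Rightarrow> 'x set" where
  "i_op X B = {x \<in> points X. \<exists>b\<in>B. spec_le (tau X) b x}"

definition d_op :: "'x bispace \<Rightarrow> 'x set \<Rightarrow> 'x set" where
  "d_op X A = {x \<in> points X. \<forall>y\<in>points X. spec_le (sigma X) x y \<longrightarrow> y \<in> A}"

definition stable :: "'x bispace \<Rightarrow> 'x set \<Rightarrow> bool" where
  "stable X A \<longleftrightarrow> A \<subseteq> points X \<and>
     (\<forall>x\<in>A. \<forall>y\<in>points X. spec_le (tau X) x y \<longrightarrow> y \<in> A) \<and> i_op X (d_op X A) = A"

text \<open>
  The intersection of a family of subsets of the space is taken inside the space, so that the
  empty family has intersection \<open>points X\<close>. In the finite intersection property the empty
  subfamily is included; this only matters for the empty space, in which no family has the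
  property and \<open>{}\<close> is therefore essential.
\<close>

definition essential :: "'x bispace \<Rightarrow> 'x set \<Rightarrow> bool" where
  "essential X A \<longleftrightarrow>
     (if A = {} then
        \<forall>\<U>. (\<forall>C\<in>\<U>. compactin (sigma X) C \<and> openin (sigma X) C) \<and>
            (\<forall>\<W>. finite \<W> \<and> \<W> \<subseteq> \<U> \<longrightarrow> points X \<inter> \<Inter>\<W> \<noteq> {})
            \<longrightarrow> points X \<inter> \<Inter>\<U> \<noteq> {}
      else compactin (tau X) A \<and> openin (sigma X) (d_op X A) \<and> stable X A)"

definition pairwise_T0 :: "'x bispace \<Rightarrow> bool" where
  "pairwise_T0 X \<longleftrightarrow> (\<forall>x\<in>points X. \<forall>y\<in>points X. x \<noteq> y \<longrightarrow>
     (\<exists>U. openin (tau X) U \<and> x \<in> U \<and> y \<notin> U) \<or> (\<exists>U. openin (sigma X) U \<and> y \<in> U \<and> x \<notin> U))"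

text \<open>
  Closure under finite intersections refers to nonempty finite families: the whole space
  need not be of the form \<open>d_op X A\<close> (it is not when a lattice without a top element is
  represented).
\<close>

definition pairwise_BD :: "'x bispace \<Rightarrow> bool" where
  "pairwise_BD X \<longleftrightarrow> topspace (sigma X) = points X \<and>
     pairwise_T0 X \<and>
     openin (tau X) = (arbitrary union_of (finite intersection_of essential X relative_to points X)) \<and>
     openin (sigma X) = (arbitrary union_of (\<lambda>U. U \<in> d_op X ` Collect (essential X))) \<and>
     (\<forall>\<F>. finite \<F> \<and> \<F> \<noteq> {} \<and> \<F> \<subseteq> d_op X ` Collect (essential X)
         \<longrightarrow> \<Inter>\<F> \<in> d_op X ` Collect (essential X)) \<and>
     (\<forall>A B. essential X A \<and> essential X B
         \<longrightarrow> essential X (A \<union> B) \<and> essential X (i_op X (d_op X (A \<inter> B)))) \<and>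
     (\<forall>V W. V \<noteq> {} \<and> W \<noteq> {} \<and> V \<subseteq> Collect (essential X) \<and> W \<subseteq> Collect (essential X) \<and>
         (\<Inter>A\<in>V. d_op X A) \<subseteq> \<Union>W
         \<longrightarrow> (\<exists>V1 W1. finite V1 \<and> V1 \<noteq> {} \<and> V1 \<subseteq> V \<and> finite W1 \<and> W1 \<noteq> {} \<and> W1 \<subseteq> W \<and>
               (\<Inter>A\<in>V1. d_op X A) \<subseteq> \<Union>W1))"

definition doubly_BD :: "'x bispace \<Rightarrow> bool" where
  "doubly_BD X \<longleftrightarrow> pairwise_BD X \<and> tau X = sigma X"


section \<open>The categories\<close>

text \<open>
  HOL has no type of all distributive lattices (or of all spaces), so each category is given by
  polymorphic predicates: the objects live over arbitrary types, and a hom-set may connect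
  objects over different types. Morphisms are extensional functions, so that equality of
  morphisms is equality in HOL; composition is \<open>compose\<close> from \<open>HOL-Library.FuncSet\<close>,
  and associativity and the unit laws are library facts about it.
\<close>

definition Dp_hom :: "'a gorder \<Rightarrow> 'b gorder \<Rightarrow> ('a \<Rightarrow> 'b) set" where
  "Dp_hom L N = {f \<in> carrier L \<rightarrow>\<^sub>E carrier N. lat_hom L N f \<and> quasi_proper L N f}"

definition Dp_id :: "'a gorder \<Rightarrow> 'a \<Rightarrow> 'a" where
  "Dp_id L = (\<lambda>x\<in>carrier L. x)"

definition Dp_iso :: "'a gorder \<Rightarrow> 'b gorder \<Rightarrow> ('a \<Rightarrow> 'b) \<Rightarrow> bool" where
  "Dp_iso L N f \<longleftrightarrow> f \<in> Dp_hom L N \<and>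
     (\<exists>g\<in>Dp_hom N L. compose (carrier L) g f = Dp_id L \<and> compose (carrier N) f g = Dp_id N)"

definition BD_hom :: "'x bispace \<Rightarrow> 'y bispace \<Rightarrow> ('x \<Rightarrow> 'y) set" where
  "BD_hom X Y = {f \<in> points X \<rightarrow>\<^sub>E points Y.
     continuous_map (tau X) (tau Y) f \<and> continuous_map (sigma X) (sigma Y) f \<and>
     (\<forall>A. essential Y A \<longrightarrow>
        essential X (f -` A \<inter> points X) \<and>
        f -` d_op Y A \<inter> points X = d_op X (f -` A \<inter> points X) \<and>
        f -` i_op Y (d_op Y A) \<inter> points X = i_op X (f -` d_op Y A \<inter> points X))}"

definition BD_id :: "'x bispace \<Rightarrow> 'x \<Rightarrow> 'x" where
  "BD_id X = (\<lambda>x\<in>points X. x)"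

definition BD_iso :: "'x bispace \<Rightarrow> 'y bispace \<Rightarrow> ('x \<Rightarrow> 'y) \<Rightarrow> bool" where
  "BD_iso X Y f \<longleftrightarrow> f \<in> BD_hom X Y \<and>
     (\<exists>g\<in>BD_hom Y X. compose (points X) g f = BD_id X \<and> compose (points Y) f g = BD_id Y)"


section \<open>The contravariant functors\<close>

definition delta :: "'a gorder \<Rightarrow> 'a \<Rightarrow> ('a set \<times> 'a set) set" where
  "delta L x = {(I, F) \<in> comaximal_pairs L. x \<notin> I}"

definition epsilon :: "'a gorder \<Rightarrow> 'a \<Rightarrow> ('a set \<times> 'a set) set" where
  "epsilon L x = {(I, F) \<in> comaximal_pairs L. x \<in> F}"

definition spec_obj :: "'a gorder \<Rightarrow> ('a set \<times> 'a set) bispace" where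
  "spec_obj L = \<lparr>
     tau = topology (arbitrary union_of
             (finite intersection_of (\<lambda>S. S \<in> delta L ` carrier L) relative_to comaximal_pairs L)),
     sigma = topology (arbitrary union_of (\<lambda>S. S \<in> epsilon L ` carrier L)) \<rparr>"

definition spec_map ::
    "'a gorder \<Rightarrow> 'b gorder \<Rightarrow> ('a \<Rightarrow> 'b) \<Rightarrow> 'b set \<times> 'b set \<Rightarrow> 'a set \<times> 'a set" where
  "spec_map L N f = (\<lambda>(I, F)\<in>comaximal_pairs N. (f -` I \<inter> carrier L, f -` F \<inter> carrier L))"

definition ess_obj :: "'x bispace \<Rightarrow> 'x set gorder" where
  "ess_obj X = \<lparr> carrier = Collect (essential X), eq = (=), le = (\<subseteq>) \<rparr>"

definition ess_map :: "'x bispace \<Rightarrow> 'y bispace \<Rightarrow> ('x \<Rightarrow> 'y) \<Rightarrow> 'y set \<Rightarrow> 'x set" where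
  "ess_map X Y f = (\<lambda>A\<in>Collect (essential Y). f -` A \<inter> points X)"

text \<open>The components of the two natural isomorphisms.\<close>

definition unit_L :: "'a gorder \<Rightarrow> 'a \<Rightarrow> ('a set \<times> 'a set) set" where
  "unit_L L = (\<lambda>x\<in>carrier L. delta L x)"

definition unit_X :: "'x bispace \<Rightarrow> 'x \<Rightarrow> 'x set set \<times> 'x set set" where
  "unit_X X = (\<lambda>x\<in>points X. ({A. essential X A \<and> x \<notin> A}, {A. essential X A \<and> x \<in> d_op X A}))"


section \<open>The topologies of the spectrum\<close>

lemma points_spec_obj: "points (spec_obj L) = comaximal_pairs L"
  by (simp add: spec_obj_def)

lemma openin_tau_spec_obj:
  "openin (tau (spec_obj L)) =
     (arbitrary union_of
        (finite intersection_of (\<lambda>S. S \<in> delta L ` carrier L) relative_to comaximal_pairs L))"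
  by (simp add: spec_obj_def fun_eq_iff openin_subbase)

lemma filter_meet_iff:
  assumes "lattice L" and F: "lat_filter L F" and x: "x \<in> carrier L" and y: "y \<in> carrier L"
  shows "x \<sqinter>\<^bsub>L\<^esub> y \<in> F \<longleftrightarrow> x \<in> F \<and> y \<in> F"
proof -
  interpret lattice L by fact
  have le: "x \<sqinter>\<^bsub>L\<^esub> y \<sqsubseteq>\<^bsub>L\<^esub> x" "x \<sqinter>\<^bsub>L\<^esub> y \<sqsubseteq>\<^bsub>L\<^esub> y"
    using x y by (rule meet_left, rule meet_right)
  have up: "b \<in> F" if "a \<in> F" "b \<in> carrier L" "a \<sqsubseteq>\<^bsub>L\<^esub> b" for a b
    using F that by (simp add: lat_filter_def)
  have meet: "a \<sqinter>\<^bsub>L\<^esub> b \<in> F" if "a \<in> F" "b \<in> F" for a b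
    using F that by (simp add: lat_filter_def)
  show ?thesis
    using up[OF _ x le(1)] up[OF _ y le(2)] meet[of x y] by iprover
qed

lemma epsilon_Int:
  assumes "lattice L" "x \<in> carrier L" "y \<in> carrier L"
  shows "epsilon L x \<inter> epsilon L y = epsilon L (x \<sqinter>\<^bsub>L\<^esub> y)"
proof -
  have "snd p \<in> Collect (lat_filter L)" if "p \<in> comaximal_pairs L" for p
    using that by (simp add: comaximal_pairs_def case_prod_beta)
  then have "x \<sqinter>\<^bsub>L\<^esub> y \<in> snd p \<longleftrightarrow> x \<in> snd p \<and> y \<in> snd p" if "p \<in> comaximal_pairs L" for p
    using filter_meet_iff[OF assms(1) _ assms(2,3), of "snd p"] that by simp
  then show ?thesis
    by (auto simp: epsilon_def)
qed

lemma openin_sigma_spec_obj: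
  assumes "lattice L"
  shows "openin (sigma (spec_obj L)) = (arbitrary union_of (\<lambda>S. S \<in> epsilon L ` carrier L))"
proof -
  interpret lattice L by fact
  have "istopology (arbitrary union_of (\<lambda>S. S \<in> epsilon L ` carrier L))"
  proof (rule istopology_base)
    fix S T
    assume "S \<in> epsilon L ` carrier L" "T \<in> epsilon L ` carrier L"
    then obtain x y where "x \<in> carrier L" "y \<in> carrier L" "S = epsilon L x" "T = epsilon L y"
      by blast
    then show "S \<inter> T \<in> epsilon L ` carrier L"
      using epsilon_Int[OF assms] meet_closed by (metis imageI)
  qed
  then show ?thesis
    by (simp add: spec_obj_def topology_inverse')
qed

lemma topspace_sigma_spec_obj:
  assumes "lattice L"
  shows "topspace (sigma (spec_obj L)) = comaximal_pairs L"
proof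
  have "epsilon L x \<subseteq> comaximal_pairs L" for x
    by (auto simp: epsilon_def)
  then have "S \<subseteq> comaximal_pairs L"
    if "(arbitrary union_of (\<lambda>S. S \<in> epsilon L ` carrier L)) S" for S
    using that unfolding union_of_def by blast
  then show "topspace (sigma (spec_obj L)) \<subseteq> comaximal_pairs L"
    using openin_sigma_spec_obj[OF assms] openin_topspace by metis
next
  show "comaximal_pairs L \<subseteq> topspace (sigma (spec_obj L))"
  proof
    fix p assume p: "p \<in> comaximal_pairs L"
    then have "snd p \<noteq> {}" "snd p \<subseteq> carrier L"
      by (simp_all add: comaximal_pairs_def lat_filter_def case_prod_beta)
    then obtain x where x: "x \<in> carrier L" "x \<in> snd p"
      by blast
    then have px: "p \<in> epsilon L x"
      using p by (simp add: epsilon_def case_prod_beta)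
    have "openin (sigma (spec_obj L)) (epsilon L x)"
      unfolding openin_sigma_spec_obj[OF assms] using x(1) by (simp add: arbitrary_union_of_inc)
    then show "p \<in> topspace (sigma (spec_obj L))"
      using px openin_subset by blast
  qed
qed

end

theory Submission
  imports Defs
begin

text \<open>
  In a distributive lattice the comaximal pairs are exactly the pairs consisting of a prime ideal
  and its complement, so \<open>delta\<close> and \<open>epsilon\<close> coincide, the two topologies of the spectrum
  agree, and the prime ideal theorem makes the sets \<open>delta L x\<close> its compact open sets. In a
  space whose two topologies agree, the operators \<open>i\<close> and \<open>d\<close> fix open sets; hence
  a nonempty set is essential iff it is compact open, and a morphism is just a map pulling essential
  sets back to essential sets. The condition attached to \<open>{}\<close> detects whether the lattice
  has a least element. For a doubly Balbes-Dwinger space, condition (v) turns a comaximal pair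
  \<open>(I, F)\<close> of essential sets into a point of \<open>\<Inter>F - \<Union>I\<close>, which is
  the surjectivity of the unit.
\<close>

section \<open>Comaximal pairs of a distributive lattice\<close>

text \<open>The lattices need not have a least or a greatest element, and this shapes the proof.
  Finite joins and meets are formed only of nonempty families, because the empty ones would call for
  bounds. The same gap explains quasi-properness: along any lattice homomorphism a prime ideal and
  its complement pull back to sets with all the closure properties of such a pair, but one of them
  may be empty. The spectrum side rests on one statement, \<open>delta_compactness\<close>. It is
  condition (v) for the sets \<open>delta L x\<close>; a singleton on the left gives their
  compactness, and \<open>{{}}\<close> on the right gives the finite intersection property attached
  to \<open>{}\<close>. On the space side every comaximal pair of essential sets comes from a point,
  so quasi-properness of a preimage map can be checked at points.\<close>

locale distributive_lattice = lattice L for L :: "'a gorder" (structure) +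
  assumes carrier_nonempty: "carrier L \<noteq> {}"
    and meet_join_distrib: "\<lbrakk>x \<in> carrier L; y \<in> carrier L; z \<in> carrier L\<rbrakk>
      \<Longrightarrow> x \<sqinter> (y \<squnion> z) = (x \<sqinter> y) \<squnion> (x \<sqinter> z)"

lemma distrib_lattice_obj_iff: "distrib_lattice_obj L \<longleftrightarrow> distributive_lattice L"
  by (auto simp: distrib_lattice_obj_def distributive_lattice_def distributive_lattice_axioms_def)

context distributive_lattice
begin

section \<open>Ideals, filters and order rules\<close>

lemma ideal_carrier: "lat_ideal L I \<Longrightarrow> x \<in> I \<Longrightarrow> x \<in> carrier L"
  by (auto simp: lat_ideal_def)

lemma filter_carrier: "lat_filter L F \<Longrightarrow> x \<in> F \<Longrightarrow> x \<in> carrier L"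
  by (auto simp: lat_filter_def)

lemma ideal_down: "lat_ideal L I \<Longrightarrow> x \<in> I \<Longrightarrow> y \<in> carrier L \<Longrightarrow> y \<sqsubseteq> x \<Longrightarrow> y \<in> I"
  by (auto simp: lat_ideal_def)

lemma ideal_join_iff:
  assumes "lat_ideal L I" "x \<in> carrier L" "y \<in> carrier L"
  shows "x \<squnion> y \<in> I \<longleftrightarrow> x \<in> I \<and> y \<in> I"
  using assms join_left[of x y] join_right[of x y] by (auto simp: lat_ideal_def)

lemma le_joinI1:
  "\<lbrakk>x \<sqsubseteq> y; x \<in> carrier L; y \<in> carrier L; z \<in> carrier L\<rbrakk> \<Longrightarrow> x \<sqsubseteq> y \<squnion> z"
  by (rule le_trans[OF _ join_left]) auto

lemma le_joinI2:
  "\<lbrakk>x \<sqsubseteq> z; x \<in> carrier L; y \<in> carrier L; z \<in> carrier L\<rbrakk> \<Longrightarrow> x \<sqsubseteq> y \<squnion> z"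
  by (rule le_trans[OF _ join_right]) auto

lemma meet_leI1:
  "\<lbrakk>x \<sqsubseteq> z; x \<in> carrier L; y \<in> carrier L; z \<in> carrier L\<rbrakk> \<Longrightarrow> x \<sqinter> y \<sqsubseteq> z"
  by (rule le_trans[OF meet_left]) auto

lemma meet_leI2:
  "\<lbrakk>y \<sqsubseteq> z; x \<in> carrier L; y \<in> carrier L; z \<in> carrier L\<rbrakk> \<Longrightarrow> x \<sqinter> y \<sqsubseteq> z"
  by (rule le_trans[OF meet_right]) auto

lemma join_mono_left:
  "\<lbrakk>x \<sqsubseteq> y; x \<in> carrier L; y \<in> carrier L; z \<in> carrier L\<rbrakk> \<Longrightarrow> x \<squnion> z \<sqsubseteq> y \<squnion> z"
  by (intro join_le le_joinI1 le_joinI2) auto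

text \<open>This is the dual distributive law, derived from the one that the locale assumes and
  stated as an inequality because it is applied to elements below joins in generated ideals.\<close>

lemma le_join_meetI:
  assumes c: "k \<in> carrier L" "x \<in> carrier L" "y \<in> carrier L" "m \<in> carrier L"
    and le: "m \<sqsubseteq> k \<squnion> x" "m \<sqsubseteq> k \<squnion> y"
  shows "m \<sqsubseteq> k \<squnion> (x \<sqinter> y)"
proof -
  \<comment> \<open>Distributivity as a case distinction: an element below
    \<open>k \<squnion> z\<close> is the join of its meets with \<open>k\<close> and with
    \<open>z\<close>, so it is enough to bound these two. Applied first with \<open>x\<close>, then
    with \<open>y\<close>.\<close>
  have split: "n \<sqsubseteq> u" if "n \<sqsubseteq> k \<squnion> z" "n \<sqinter> k \<sqsubseteq> u" "n \<sqinter> z \<sqsubseteq> u"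
    "n \<in> carrier L" "z \<in> carrier L" "u \<in> carrier L" for n z u
  proof -
    have "n \<sqinter> (k \<squnion> z) = n"
      using that c le_iff_join[of n "k \<squnion> z"] by simp
    then have "n = (n \<sqinter> k) \<squnion> (n \<sqinter> z)"
      using that c by (simp add: meet_join_distrib)
    also have "\<dots> \<sqsubseteq> u"
      using that c by (intro join_le) auto
    finally show ?thesis .
  qed
  show ?thesis
  proof (rule split[OF le(1)])
    show "m \<sqinter> x \<sqsubseteq> k \<squnion> (x \<sqinter> y)"
    proof (rule split[where z = y])
      show "m \<sqinter> x \<sqsubseteq> k \<squnion> y"
        using c le by (intro meet_leI1) auto
      show "m \<sqinter> x \<sqinter> k \<sqsubseteq> k \<squnion> (x \<sqinter> y)"
        using c by (intro le_joinI1 meet_leI2) auto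
      show "m \<sqinter> x \<sqinter> y \<sqsubseteq> k \<squnion> (x \<sqinter> y)"
        using c by (intro le_joinI2 meet_le meet_left meet_leI1 meet_leI2) auto
    qed (use c in auto)
    show "m \<sqinter> k \<sqsubseteq> k \<squnion> (x \<sqinter> y)"
      using c by (intro le_joinI1 meet_leI2) auto
  qed (use c in auto)
qed

text \<open>The least ideal containing \<open>I\<close> and \<open>x\<close>. It is the larger ideal
  against which the maximality of \<open>I\<close> is tested.\<close>

lemma lat_ideal_generated:
  assumes I: "lat_ideal L I" and x: "x \<in> carrier L"
  shows "lat_ideal L {z \<in> carrier L. \<exists>i\<in>I. z \<sqsubseteq> i \<squnion> x}" (is "lat_ideal L ?J")
  unfolding lat_ideal_def
proof (intro conjI ballI impI)
  obtain i where "i \<in> I"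
    using I by (auto simp: lat_ideal_def)
  then show "?J \<noteq> {}"
    using x ideal_carrier[OF I] join_right by blast
  show "z \<in> ?J" if "y \<in> ?J" "z \<in> carrier L" "z \<sqsubseteq> y" for y z
    using that x ideal_carrier[OF I] by (auto intro!: le_trans[of z y])
  show "y \<squnion> z \<in> ?J" if *: "y \<in> ?J" "z \<in> ?J" for y z
  proof -
    obtain i j where ij: "i \<in> I" "j \<in> I" and le: "y \<sqsubseteq> i \<squnion> x" "z \<sqsubseteq> j \<squnion> x"
      and yz: "y \<in> carrier L" "z \<in> carrier L"
      using * by auto
    have c: "i \<in> carrier L" "j \<in> carrier L" "i \<squnion> j \<in> carrier L"
      using ij ideal_carrier[OF I] by auto
    have "i \<squnion> x \<sqsubseteq> (i \<squnion> j) \<squnion> x" "j \<squnion> x \<sqsubseteq> (i \<squnion> j) \<squnion> x"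
      using c x by (auto intro: join_mono_left join_left join_right)
    then have "y \<squnion> z \<sqsubseteq> (i \<squnion> j) \<squnion> x"
      using le yz c x by (auto intro!: join_le elim: le_trans)
    moreover have "i \<squnion> j \<in> I"
      using I ij by (auto simp: lat_ideal_def)
    ultimately show ?thesis
      using yz by auto
  qed
qed auto

text \<open>An ideal that is maximal among those missing a filter is prime. For \<open>x\<close> and
  \<open>y\<close> outside \<open>I\<close>, the ideals generated by \<open>I\<close> with
  \<open>x\<close> and by \<open>I\<close> with \<open>y\<close> meet \<open>F\<close>, say in
  \<open>a\<close> and \<open>b\<close>. If \<open>x \<sqinter> y\<close> were in \<open>I\<close>,
  then by distributivity \<open>a \<sqinter> b\<close> would lie in both \<open>I\<close> and
  \<open>F\<close>.\<close>

lemma lat_filter_complement: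
  assumes I: "lat_ideal L I" and F: "lat_filter L F" and disj: "I \<inter> F = {}"
    and max: "\<And>J. lat_ideal L J \<Longrightarrow> I \<subset> J \<Longrightarrow> J \<inter> F \<noteq> {}"
  shows "lat_filter L (carrier L - I)"
  unfolding lat_filter_def
proof (intro conjI ballI impI)
  have "F \<noteq> {}" "F \<subseteq> carrier L"
    using F by (simp_all add: lat_filter_def)
  then show "carrier L - I \<noteq> {}"
    using disj by blast
  show "y \<in> carrier L - I" if "x \<in> carrier L - I" "y \<in> carrier L" "x \<sqsubseteq> y" for x y
    using that ideal_down[OF I] by auto
  show "x \<sqinter> y \<in> carrier L - I" if xy: "x \<in> carrier L - I" "y \<in> carrier L - I" for x y
  proof
    have meets: "\<exists>i\<in>I. \<exists>a\<in>F. a \<sqsubseteq> i \<squnion> x" if x: "x \<in> carrier L - I" for x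
    proof -
      let ?J = "{z \<in> carrier L. \<exists>i\<in>I. z \<sqsubseteq> i \<squnion> x}"
      obtain i where "i \<in> I"
        using I by (auto simp: lat_ideal_def)
      then have "x \<in> ?J"
        using x ideal_carrier[OF I] join_right by blast
      moreover have "I \<subseteq> ?J"
        using x ideal_carrier[OF I] join_left by blast
      ultimately have "I \<subset> ?J"
        using x by blast
      then show ?thesis
        using max[of ?J] lat_ideal_generated[OF I] x by blast
    qed
    obtain i a j b where ij: "i \<in> I" "j \<in> I" and ab: "a \<in> F" "b \<in> F"
      and le: "a \<sqsubseteq> i \<squnion> x" "b \<sqsubseteq> j \<squnion> y"
      using meets[OF xy(1)] meets[OF xy(2)] by blast
    have c: "i \<in> carrier L" "j \<in> carrier L" "a \<in> carrier L" "b \<in> carrier L"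
      "x \<in> carrier L" "y \<in> carrier L"
      using ij ab xy ideal_carrier[OF I] filter_carrier[OF F] by auto
    \<comment> \<open>Both bounds are raised to the common element \<open>i \<squnion> j\<close> of
      \<open>I\<close>, as \<open>le_join_meetI\<close> needs one \<open>k\<close>.\<close>
    have "i \<squnion> x \<sqsubseteq> (i \<squnion> j) \<squnion> x" "j \<squnion> y \<sqsubseteq> (i \<squnion> j) \<squnion> y"
      using c by (auto intro: join_mono_left join_left join_right)
    then have "a \<sqsubseteq> (i \<squnion> j) \<squnion> x" "b \<sqsubseteq> (i \<squnion> j) \<squnion> y"
      using le c by (auto intro: le_trans)
    then have "a \<sqinter> b \<sqsubseteq> (i \<squnion> j) \<squnion> x" "a \<sqinter> b \<sqsubseteq> (i \<squnion> j) \<squnion> y"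
      using c by (auto intro: meet_leI1 meet_leI2)
    then have *: "a \<sqinter> b \<sqsubseteq> (i \<squnion> j) \<squnion> (x \<sqinter> y)"
      using c by (simp add: le_join_meetI)
    show "x \<sqinter> y \<notin> I"
    proof
      assume "x \<sqinter> y \<in> I"
      then have "(i \<squnion> j) \<squnion> (x \<sqinter> y) \<in> I"
        using I ij by (simp add: lat_ideal_def)
      then have "a \<sqinter> b \<in> I"
        using ideal_down[OF I _ _ *] c by simp
      moreover have "a \<sqinter> b \<in> F"
        using F ab by (simp add: lat_filter_def)
      ultimately show False
        using disj by blast
    qed
    show "x \<sqinter> y \<in> carrier L"
      using c by simp
  qed
qed auto

text \<open>Maximality of \<open>I\<close> makes its complement a filter; it contains
  \<open>F\<close>, so maximality of \<open>F\<close> makes them equal. Conversely, two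
  complementary halves leave no room: whatever properly extends one meets the other.\<close>

lemma comaximal_pairs_iff:
  "(I, F) \<in> comaximal_pairs L \<longleftrightarrow>
     lat_ideal L I \<and> lat_filter L F \<and> I \<inter> F = {} \<and> I \<union> F = carrier L"
proof
  assume "(I, F) \<in> comaximal_pairs L"
  then have I: "lat_ideal L I" and F: "lat_filter L F" and disj: "I \<inter> F = {}"
    and maxI: "\<And>J. lat_ideal L J \<Longrightarrow> I \<subset> J \<Longrightarrow> J \<inter> F \<noteq> {}"
    and maxF: "\<And>K. lat_filter L K \<Longrightarrow> F \<subset> K \<Longrightarrow> K \<inter> I \<noteq> {}"
    by (auto simp: comaximal_pairs_def)
  have "F \<subseteq> carrier L"
    using F by (simp add: lat_filter_def)
  then have "F \<subseteq> carrier L - I"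
    using disj by blast
  then have "F = carrier L - I"
    using maxF[OF lat_filter_complement[OF I F disj maxI]] by blast
  then show "lat_ideal L I \<and> lat_filter L F \<and> I \<inter> F = {} \<and> I \<union> F = carrier L"
    using I F by (auto simp: lat_ideal_def)
next
  assume *: "lat_ideal L I \<and> lat_filter L F \<and> I \<inter> F = {} \<and> I \<union> F = carrier L"
  moreover have "J \<inter> F \<noteq> {}" if "lat_ideal L J" "I \<subset> J" for J
  proof -
    have "J \<subseteq> I \<union> F"
      using * that(1) by (simp add: lat_ideal_def)
    then show ?thesis
      using that(2) by blast
  qed
  moreover have "K \<inter> I \<noteq> {}" if "lat_filter L K" "F \<subset> K" for K
  proof -
    have "K \<subseteq> I \<union> F"
      using * that(1) by (simp add: lat_filter_def)
    then show ?thesis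
      using that(2) by blast
  qed
  ultimately show "(I, F) \<in> comaximal_pairs L"
    by (simp add: comaximal_pairs_def)
qed

lemma ideal_filter_separation:
  assumes I: "lat_ideal L I" and F: "lat_filter L F" and disj: "I \<inter> F = {}"
  obtains P Q where "(P, Q) \<in> comaximal_pairs L" "I \<subseteq> P" "F \<subseteq> Q"
proof -
  define \<A> where "\<A> = {J. lat_ideal L J \<and> I \<subseteq> J \<and> J \<inter> F = {}}"
  have "\<exists>P\<in>\<A>. \<forall>J\<in>\<A>. P \<subseteq> J \<longrightarrow> J = P"
  proof (rule subset_Zorn_nonempty)
    show "\<A> \<noteq> {}"
      using assms by (auto simp: \<A>_def)
    fix \<C> assume ne: "\<C> \<noteq> {}" and ch: "subset.chain \<A> \<C>"
    have ideal: "lat_ideal L J" if "J \<in> \<C>" for J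
      using that ch by (auto simp: subset_chain_def \<A>_def)
    have "lat_ideal L (\<Union>\<C>)"
      unfolding lat_ideal_def
    proof (intro conjI ballI impI)
      show "\<Union>\<C> \<noteq> {}"
        using ne ideal by (fastforce simp: lat_ideal_def)
      show "\<Union>\<C> \<subseteq> carrier L"
        using ideal ideal_carrier by blast
      show "y \<in> \<Union>\<C>" if "x \<in> \<Union>\<C>" "y \<in> carrier L" "y \<sqsubseteq> x" for x y
        using that ideal ideal_down by blast
      show "x \<squnion> y \<in> \<Union>\<C>" if xy: "x \<in> \<Union>\<C>" "y \<in> \<Union>\<C>" for x y
      proof -
        obtain J where "J \<in> \<C>" "x \<in> J" "y \<in> J"
          using xy ch unfolding subset_chain_def by blast
        then have "x \<squnion> y \<in> J"
          using ideal[of J] by (simp add: lat_ideal_def)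
        then show ?thesis
          using \<open>J \<in> \<C>\<close> by blast
      qed
    qed
    then show "\<Union>\<C> \<in> \<A>"
      using ne ch by (auto simp: subset_chain_def \<A>_def)
  qed
  then obtain P where P: "P \<in> \<A>" and max: "\<And>J. J \<in> \<A> \<Longrightarrow> P \<subseteq> J \<Longrightarrow> J = P"
    by blast
  have "lat_filter L (carrier L - P)"
  proof (rule lat_filter_complement)
    \<comment> \<open>\<open>P\<close> is maximal only within \<open>\<A>\<close>, but an ideal
      above \<open>P\<close> also contains \<open>I\<close>, so missing \<open>F\<close> would put
      it into \<open>\<A>\<close>.\<close>
    show "J \<inter> F \<noteq> {}" if "lat_ideal L J" "P \<subset> J" for J
      using that max[of J] P by (auto simp: \<A>_def)
  qed (use P F in \<open>auto simp: \<A>_def\<close>)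
  then have "(P, carrier L - P) \<in> comaximal_pairs L"
    using P ideal_carrier by (auto simp: comaximal_pairs_iff \<A>_def)
  moreover have "I \<subseteq> P" "F \<subseteq> carrier L - P"
    using P filter_carrier[OF F] by (auto simp: \<A>_def)
  ultimately show ?thesis
    by (rule that)
qed

section \<open>\<open>delta\<close> as a lattice embedding, and its compactness property\<close>

lemma delta_subset: "delta L x \<subseteq> comaximal_pairs L"
  by (auto simp: delta_def)

lemma mem_delta_iff: "(I, F) \<in> comaximal_pairs L \<Longrightarrow> (I, F) \<in> delta L x \<longleftrightarrow> x \<notin> I"
  by (simp add: delta_def)

lemma comaximal_complement:
  assumes "(I, F) \<in> comaximal_pairs L" "x \<in> carrier L"
  shows "x \<in> F \<longleftrightarrow> x \<notin> I"
  using assms by (auto simp: comaximal_pairs_iff)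

lemma delta_eq_epsilon: "x \<in> carrier L \<Longrightarrow> delta L x = epsilon L x"
  using comaximal_complement by (auto simp: delta_def epsilon_def)

text \<open>Primeness enters through the passage to \<open>epsilon\<close>: filters see meets,
  ideals see joins, and a pair of complementary halves sees both.\<close>

lemma delta_meet:
  assumes "x \<in> carrier L" "y \<in> carrier L"
  shows "delta L (x \<sqinter> y) = delta L x \<inter> delta L y"
  using assms by (simp add: delta_eq_epsilon epsilon_Int[OF lattice_axioms])

lemma delta_join:
  assumes "x \<in> carrier L" "y \<in> carrier L"
  shows "delta L (x \<squnion> y) = delta L x \<union> delta L y"
proof -
  have "x \<squnion> y \<in> I \<longleftrightarrow> x \<in> I \<and> y \<in> I" if "(I, F) \<in> comaximal_pairs L" for I F
    using that assms by (simp add: comaximal_pairs_iff ideal_join_iff)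
  then show ?thesis
    by (auto simp: delta_def)
qed

text \<open>If \<open>x\<close> is not below \<open>y\<close>, the principal filter of
  \<open>x\<close> misses the principal ideal of \<open>y\<close>, and a comaximal pair separating
  them lies in \<open>delta L x\<close> but not in \<open>delta L y\<close>.\<close>

lemma delta_subset_iff:
  assumes "x \<in> carrier L" "y \<in> carrier L"
  shows "delta L x \<subseteq> delta L y \<longleftrightarrow> x \<sqsubseteq> y"
proof
  assume "x \<sqsubseteq> y"
  then show "delta L x \<subseteq> delta L y"
    using assms delta_meet[of x y] le_iff_join[of x y] by auto
next
  assume sub: "delta L x \<subseteq> delta L y"
  show "x \<sqsubseteq> y"
  proof (rule ccontr)
    assume "\<not> x \<sqsubseteq> y"
    moreover have "lat_ideal L {z \<in> carrier L. z \<sqsubseteq> y}"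
      using assms by (auto simp: lat_ideal_def intro: le_trans join_le)
    moreover have "lat_filter L {z \<in> carrier L. x \<sqsubseteq> z}"
      using assms by (auto simp: lat_filter_def intro: le_trans meet_le)
    ultimately obtain P Q where PQ: "(P, Q) \<in> comaximal_pairs L"
      and "{z \<in> carrier L. z \<sqsubseteq> y} \<subseteq> P" "{z \<in> carrier L. x \<sqsubseteq> z} \<subseteq> Q"
      using ideal_filter_separation assms le_trans by (smt (verit) disjoint_iff mem_Collect_eq)
    then have "(P, Q) \<in> delta L x" "(P, Q) \<notin> delta L y"
      using assms comaximal_complement[OF PQ] by (auto simp: mem_delta_iff)
    then show False
      using sub by blast
  qed
qed

lemma inj_on_delta: "inj_on (delta L) (carrier L)"
  by (rule inj_onI) (metis delta_subset_iff le_antisym order_refl)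

lemma delta_Inter:
  assumes "finite S" "S \<noteq> {}" "S \<subseteq> delta L ` carrier L"
  shows "\<Inter>S \<in> delta L ` carrier L"
  using assms
proof (induction rule: finite_ne_induct)
  case (insert D S)
  then obtain x y where "x \<in> carrier L" "D = delta L x" "y \<in> carrier L" "\<Inter>S = delta L y"
    by auto
  then show ?case
    by (simp flip: delta_meet)
qed auto

lemma delta_Union:
  assumes "finite S" "S \<noteq> {}" "S \<subseteq> delta L ` carrier L"
  shows "\<Union>S \<in> delta L ` carrier L"
  using assms
proof (induction rule: finite_ne_induct)
  case (insert D S)
  then obtain x y where "x \<in> carrier L" "D = delta L x" "y \<in> carrier L" "\<Union>S = delta L y"
    by auto
  then show ?case
    by (simp flip: delta_join)
qed auto

text \<open>If no finite subfamilies worked, the filter generated by \<open>V\<close> and the ideal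
  generated by \<open>W\<close> would be disjoint, and a comaximal pair separating them would be a
  point of \<open>\<Inter>V\<close> outside \<open>\<Union>W\<close>. A common element
  \<open>z\<close> instead yields
  \<open>\<Inter>S \<subseteq> delta L z \<subseteq> \<Union>T\<close> with \<open>S\<close> and
  \<open>T\<close> finite.\<close>

lemma delta_compactness:
  assumes V: "V \<subseteq> delta L ` carrier L" "V \<noteq> {}" and W: "W \<subseteq> delta L ` carrier L" "W \<noteq> {}"
    and sub: "\<Inter>V \<subseteq> \<Union>W"
  shows "\<exists>V1 W1. finite V1 \<and> V1 \<noteq> {} \<and> V1 \<subseteq> V \<and> finite W1 \<and> W1 \<noteq> {} \<and> W1 \<subseteq> W \<and> \<Inter>V1 \<subseteq> \<Union>W1"
proof -
  \<comment> \<open>the filter generated by \<open>V\<close> and the ideal generated by \<open>W\<close>, described through the sets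
    \<open>delta L z\<close> to avoid finite meets and joins\<close>
  define F where "F = {z \<in> carrier L. \<exists>S. finite S \<and> S \<noteq> {} \<and> S \<subseteq> V \<and> \<Inter>S \<subseteq> delta L z}"
  define I where "I = {z \<in> carrier L. \<exists>T. finite T \<and> T \<noteq> {} \<and> T \<subseteq> W \<and> delta L z \<subseteq> \<Union>T}"
  have memF: "x \<in> F"
    if "x \<in> carrier L" "finite S" "S \<noteq> {}" "S \<subseteq> V" "\<Inter>S \<subseteq> delta L x" for x S
    unfolding F_def using that by blast
  have memI: "x \<in> I"
    if "x \<in> carrier L" "finite T" "T \<noteq> {}" "T \<subseteq> W" "delta L x \<subseteq> \<Union>T" for x T
    unfolding I_def using that by blast
  have FI: "x \<in> F" if "x \<in> carrier L" "delta L x \<in> V" for x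
    using that by (intro memF[of x "{delta L x}"]) auto
  have II: "x \<in> I" if "x \<in> carrier L" "delta L x \<in> W" for x
    using that by (intro memI[of x "{delta L x}"]) auto
  have F: "lat_filter L F"
    unfolding lat_filter_def
  proof (intro conjI ballI impI)
    obtain x where "x \<in> carrier L" "delta L x \<in> V"
      using V by auto
    then show "F \<noteq> {}"
      using FI by blast
    show "F \<subseteq> carrier L"
      by (auto simp: F_def)
    show "y \<in> F" if "x \<in> F" "y \<in> carrier L" "x \<sqsubseteq> y" for x y
      using that delta_subset_iff[of x y] unfolding F_def by blast
    show "x \<sqinter> y \<in> F" if xy: "x \<in> F" "y \<in> F" for x y
    proof -
      obtain S T where S: "finite S" "S \<noteq> {}" "S \<subseteq> V" "\<Inter>S \<subseteq> delta L x"
        and T: "finite T" "T \<subseteq> V" "\<Inter>T \<subseteq> delta L y" and c: "x \<in> carrier L" "y \<in> carrier L"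
        using xy unfolding F_def by blast
      have "\<Inter>(S \<union> T) \<subseteq> delta L (x \<sqinter> y)"
        using S(4) T(3) c by (simp add: delta_meet Inter_Un_distrib) blast
      then show ?thesis
        using S T c by (intro memF[of _ "S \<union> T"]) auto
    qed
  qed
  have I: "lat_ideal L I"
    unfolding lat_ideal_def
  proof (intro conjI ballI impI)
    obtain x where "x \<in> carrier L" "delta L x \<in> W"
      using W by auto
    then show "I \<noteq> {}"
      using II by blast
    show "I \<subseteq> carrier L"
      by (auto simp: I_def)
    show "y \<in> I" if "x \<in> I" "y \<in> carrier L" "y \<sqsubseteq> x" for x y
      using that delta_subset_iff[of y x] unfolding I_def by blast
    show "x \<squnion> y \<in> I" if xy: "x \<in> I" "y \<in> I" for x y
    proof -
      obtain S T where S: "finite S" "S \<noteq> {}" "S \<subseteq> W" "delta L x \<subseteq> \<Union>S"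
        and T: "finite T" "T \<subseteq> W" "delta L y \<subseteq> \<Union>T" and c: "x \<in> carrier L" "y \<in> carrier L"
        using xy unfolding I_def by blast
      have "delta L (x \<squnion> y) \<subseteq> \<Union>(S \<union> T)"
        using S(4) T(3) c by (simp add: delta_join) blast
      then show ?thesis
        using S T c by (intro memI[of _ "S \<union> T"]) auto
    qed
  qed
  have "I \<inter> F \<noteq> {}"
  proof
    assume "I \<inter> F = {}"
    then obtain P Q where PQ: "(P, Q) \<in> comaximal_pairs L" and IF: "I \<subseteq> P" "F \<subseteq> Q"
      using ideal_filter_separation[OF I F] by blast
    have "(P, Q) \<in> D" if "D \<in> V" for D
    proof -
      obtain x where "x \<in> carrier L" "D = delta L x"
        using V \<open>D \<in> V\<close> by blast
      then show ?thesis
        using FI IF comaximal_complement[OF PQ, of x] \<open>D \<in> V\<close> by (auto simp: mem_delta_iff[OF PQ])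
    qed
    moreover have "(P, Q) \<notin> D" if "D \<in> W" for D
    proof -
      obtain x where "x \<in> carrier L" "D = delta L x"
        using W \<open>D \<in> W\<close> by blast
      then show ?thesis
        using II IF \<open>D \<in> W\<close> by (auto simp: mem_delta_iff[OF PQ])
    qed
    ultimately have "(P, Q) \<in> \<Inter>V" "(P, Q) \<notin> \<Union>W"
      by auto
    then show False
      using sub by (meson subsetD)
  qed
  then obtain z where "z \<in> I" "z \<in> F"
    by blast
  then obtain S T where S: "finite S" "S \<noteq> {}" "S \<subseteq> V" "\<Inter>S \<subseteq> delta L z"
    and T: "finite T" "T \<noteq> {}" "T \<subseteq> W" "delta L z \<subseteq> \<Union>T"
    unfolding I_def F_def by blast
  then show ?thesis
    by (intro exI[of _ S] exI[of _ T] conjI subset_trans[OF S(4) T(4)])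
qed

end

section \<open>Quasi-proper homomorphisms\<close>

lemma lat_hom_mono:
  assumes "lattice L" "lattice N" "lat_hom L N f" "x \<in> carrier L" "y \<in> carrier L" "x \<sqsubseteq>\<^bsub>L\<^esub> y"
  shows "f x \<sqsubseteq>\<^bsub>N\<^esub> f y"
proof -
  \<comment> \<open>despite its name, \<open>le_iff_join\<close> of HOL-Algebra characterises the order by the meet\<close>
  have "x = x \<sqinter>\<^bsub>L\<^esub> y"
    using assms by (simp flip: lattice.le_iff_join)
  then have "f x = f x \<sqinter>\<^bsub>N\<^esub> f y"
    using assms by (metis lat_hom_def)
  moreover have "f x \<in> carrier N" "f y \<in> carrier N"
    using assms by (auto simp: lat_hom_def)
  ultimately show ?thesis
    using assms by (simp add: lattice.le_iff_join)
qed

text \<open>Closure properties, disjointness and covering all pull back along a homomorphism;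
  nonemptiness is the one thing that has to be supplied.\<close>

lemma comaximal_pairs_preimage:
  assumes L: "distributive_lattice L" and N: "distributive_lattice N" and f: "lat_hom L N f"
    and IF: "(I, F) \<in> comaximal_pairs N"
    and ne: "f -` I \<inter> carrier L \<noteq> {}" "f -` F \<inter> carrier L \<noteq> {}"
  shows "(f -` I \<inter> carrier L, f -` F \<inter> carrier L) \<in> comaximal_pairs L"
proof -
  interpret L: distributive_lattice L by fact
  interpret N: distributive_lattice N by fact
  have fc: "f x \<in> carrier N" if "x \<in> carrier L" for x
    using f that by (auto simp: lat_hom_def)
  have fhom: "f (x \<squnion>\<^bsub>L\<^esub> y) = f x \<squnion>\<^bsub>N\<^esub> f y" "f (x \<sqinter>\<^bsub>L\<^esub> y) = f x \<sqinter>\<^bsub>N\<^esub> f y"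
    if "x \<in> carrier L" "y \<in> carrier L" for x y
    using f that by (auto simp: lat_hom_def)
  note mono = lat_hom_mono[OF L.lattice_axioms N.lattice_axioms f]
  have I: "lat_ideal N I" and F: "lat_filter N F"
    and disj: "I \<inter> F = {}" and cov: "I \<union> F = carrier N"
    using IF by (auto simp: N.comaximal_pairs_iff)
  have "lat_ideal L (f -` I \<inter> carrier L)"
    unfolding lat_ideal_def
  proof (intro conjI ballI impI)
    show "y \<in> f -` I \<inter> carrier L"
      if "x \<in> f -` I \<inter> carrier L" "y \<in> carrier L" "y \<sqsubseteq>\<^bsub>L\<^esub> x" for x y
      using that N.ideal_down[OF I, of "f x" "f y"] mono[of y x] fc by simp
    show "x \<squnion>\<^bsub>L\<^esub> y \<in> f -` I \<inter> carrier L"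
      if "x \<in> f -` I \<inter> carrier L" "y \<in> f -` I \<inter> carrier L" for x y
      using that N.ideal_join_iff[OF I, of "f x" "f y"] fc fhom by simp
  qed (use ne in auto)
  moreover have "lat_filter L (f -` F \<inter> carrier L)"
    unfolding lat_filter_def
  proof (intro conjI ballI impI)
    show "y \<in> f -` F \<inter> carrier L"
      if "x \<in> f -` F \<inter> carrier L" "y \<in> carrier L" "x \<sqsubseteq>\<^bsub>L\<^esub> y" for x y
      using that F mono[of x y] fc[of y] unfolding lat_filter_def by blast
    show "x \<sqinter>\<^bsub>L\<^esub> y \<in> f -` F \<inter> carrier L"
      if "x \<in> f -` F \<inter> carrier L" "y \<in> f -` F \<inter> carrier L" for x y
      using that filter_meet_iff[OF N.lattice_axioms F, of "f x" "f y"] fc fhom by simp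
  qed (use ne in auto)
  ultimately show ?thesis
    using disj cov fc unfolding L.comaximal_pairs_iff by blast
qed

text \<open>A surjection hits every nonempty ideal and filter. This serves identities and both
  directions of an isomorphism.\<close>

lemma quasi_proper_if_surj:
  assumes L: "distributive_lattice L" and N: "distributive_lattice N" and f: "lat_hom L N f"
    and surj: "f ` carrier L = carrier N"
  shows "quasi_proper L N f"
proof -
  interpret N: distributive_lattice N by fact
  have "(f -` I \<inter> carrier L, f -` F \<inter> carrier L) \<in> comaximal_pairs L"
    if IF: "(I, F) \<in> comaximal_pairs N" for I F
  proof (rule comaximal_pairs_preimage[OF L N f IF])
    have "I \<subseteq> f ` carrier L" "I \<noteq> {}" "F \<subseteq> f ` carrier L" "F \<noteq> {}"
      using IF surj by (auto simp: N.comaximal_pairs_iff lat_ideal_def lat_filter_def)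
    then show "f -` I \<inter> carrier L \<noteq> {}" "f -` F \<inter> carrier L \<noteq> {}"
      by blast+
  qed
  then show ?thesis
    by (auto simp: quasi_proper_def)
qed

lemma comaximal_pairs_vimage:
  assumes "f \<in> Dp_hom L N" "(I, F) \<in> comaximal_pairs N"
  shows "(f -` I \<inter> carrier L, f -` F \<inter> carrier L) \<in> comaximal_pairs L"
  using assms by (auto simp: Dp_hom_def quasi_proper_def)

lemma Dp_id_in_hom:
  assumes "distributive_lattice L"
  shows "Dp_id L \<in> Dp_hom L L"
proof -
  interpret distributive_lattice L by fact
  have "lat_hom L L (Dp_id L)"
    by (simp add: lat_hom_def Dp_id_def)
  moreover have "Dp_id L ` carrier L = carrier L"
    by (simp add: Dp_id_def)
  ultimately show ?thesis
    using quasi_proper_if_surj[OF assms assms] by (auto simp: Dp_hom_def Dp_id_def)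
qed

lemma compose_in_Dp_hom:
  assumes L: "distributive_lattice L" and f: "f \<in> Dp_hom L M" and g: "g \<in> Dp_hom M N"
  shows "compose (carrier L) g f \<in> Dp_hom L N"
proof -
  interpret distributive_lattice L by fact
  have fc: "f x \<in> carrier M" if "x \<in> carrier L" for x
    using f that by (auto simp: Dp_hom_def)
  have gc: "g x \<in> carrier N" if "x \<in> carrier M" for x
    using g that by (auto simp: Dp_hom_def)
  have "compose (carrier L) g f -` A \<inter> carrier L = f -` (g -` A \<inter> carrier M) \<inter> carrier L" for A
    using fc by (auto simp: compose_def)
  then have "quasi_proper L N (compose (carrier L) g f)"
    using comaximal_pairs_vimage[OF f comaximal_pairs_vimage[OF g]] by (auto simp: quasi_proper_def)
  moreover have "lat_hom L N (compose (carrier L) g f)"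
    using f g fc gc by (simp add: Dp_hom_def lat_hom_def compose_def)
  ultimately show ?thesis
    using fc gc by (auto simp: Dp_hom_def compose_def)
qed


section \<open>Spaces whose two topologies agree\<close>

lemma i_op_openin:
  assumes "openin (tau X) U"
  shows "i_op X U = U"
  using assms openin_subset[OF assms] by (auto simp: i_op_def spec_le_def)

lemma d_op_openin:
  assumes "tau X = sigma X" "openin (tau X) U"
  shows "d_op X U = U"
  using assms openin_subset[OF assms(2)] by (auto simp: d_op_def spec_le_def)

text \<open>The clause of \<open>essential\<close> for \<open>{}\<close>, isolated as a property of
  one topology so that it can be evaluated for the spectrum separately.\<close>

definition compact_open_fip :: "'x topology \<Rightarrow> bool" where
  "compact_open_fip T \<longleftrightarrow>
     (\<forall>\<U>. (\<forall>C\<in>\<U>. compactin T C \<and> openin T C) \<and>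
          (\<forall>\<W>. finite \<W> \<and> \<W> \<subseteq> \<U> \<longrightarrow> topspace T \<inter> \<Inter>\<W> \<noteq> {})
          \<longrightarrow> topspace T \<inter> \<Inter>\<U> \<noteq> {})"

text \<open>\<open>essential\<close> does not ask a nonempty \<open>A\<close> to be open. Openness
  comes from stability: \<open>A\<close> equals i(d(A)), and i fixes the open set d(A).\<close>

lemma essential_iff:
  assumes "tau X = sigma X"
  shows "essential X A \<longleftrightarrow>
    compactin (tau X) A \<and> openin (tau X) A \<and> (A = {} \<longrightarrow> compact_open_fip (tau X))"
proof (cases "A = {}")
  case True
  then show ?thesis
    using assms by (simp add: essential_def compact_open_fip_def)
next
  case False
  have "openin (tau X) A" if "openin (tau X) (d_op X A)" "stable X A"
    using that i_op_openin[OF that(1)] by (simp add: stable_def)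
  moreover have "openin (tau X) (d_op X A)" "stable X A" if A: "openin (tau X) A"
    using A openin_subset[OF A] d_op_openin[OF assms A] i_op_openin[OF A]
    by (auto simp: stable_def spec_le_def)
  ultimately show ?thesis
    using False assms by (auto simp: essential_def)
qed

text \<open>Once d and i act as the identity on essential sets and their intersections, (iii) says
  that the essential sets form a base. This implies (ii), and closure under finite intersections
  follows by induction from the binary case in (iv).\<close>

lemma doubly_BD_iff:
  "doubly_BD X \<longleftrightarrow> tau X = sigma X \<and> pairwise_T0 X \<and>
     openin (tau X) = arbitrary union_of essential X \<and>
     (\<forall>A B. essential X A \<and> essential X B \<longrightarrow> essential X (A \<union> B) \<and> essential X (A \<inter> B)) \<and>
     (\<forall>V W. V \<noteq> {} \<and> W \<noteq> {} \<and> V \<subseteq> Collect (essential X) \<and> W \<subseteq> Collect (essential X) \<and>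
         \<Inter>V \<subseteq> \<Union>W
         \<longrightarrow> (\<exists>V1 W1. finite V1 \<and> V1 \<noteq> {} \<and> V1 \<subseteq> V \<and> finite W1 \<and> W1 \<noteq> {} \<and> W1 \<subseteq> W \<and>
               \<Inter>V1 \<subseteq> \<Union>W1))"
    (is "_ \<longleftrightarrow> _ \<and> _ \<and> ?base \<and> ?latt \<and> ?fin")
proof (cases "tau X = sigma X")
  case eq: True
  have op: "openin (tau X) A" if "essential X A" for A
    using that essential_iff[OF eq] by blast
  have d: "d_op X A = A" if "essential X A" for A
    using d_op_openin[OF eq op[OF that]] .
  have id: "i_op X (d_op X (A \<inter> B)) = A \<inter> B" if "essential X A" "essential X B" for A B
    using i_op_openin d_op_openin[OF eq] openin_Int[OF op[OF that(1)] op[OF that(2)]] by metis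
  have dE: "d_op X ` Collect (essential X) = Collect (essential X)"
    using d by force
  have dV: "(\<Inter>A\<in>V. d_op X A) = \<Inter>V" if "V \<subseteq> Collect (essential X)" for V
    using that d by (auto simp: subset_iff)
  have latt: "?latt \<longleftrightarrow> (\<forall>A B. essential X A \<and> essential X B
         \<longrightarrow> essential X (A \<union> B) \<and> essential X (i_op X (d_op X (A \<inter> B))))"
    using id by metis
  have fin: "?fin \<longleftrightarrow> (\<forall>V W. V \<noteq> {} \<and> W \<noteq> {} \<and> V \<subseteq> Collect (essential X) \<and> W \<subseteq> Collect (essential X) \<and>
         (\<Inter>A\<in>V. d_op X A) \<subseteq> \<Union>W
         \<longrightarrow> (\<exists>V1 W1. finite V1 \<and> V1 \<noteq> {} \<and> V1 \<subseteq> V \<and> finite W1 \<and> W1 \<noteq> {} \<and> W1 \<subseteq> W \<and>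
               (\<Inter>A\<in>V1. d_op X A) \<subseteq> \<Union>W1))"
    apply (rule iff_allI)+
    using dV by (smt (verit, del_insts) order_trans)
  \<comment> \<open>A base is also a subbasis: its members are open, so finite intersections add
    nothing new.\<close>
  have sub: "openin (tau X) = (arbitrary union_of (finite intersection_of essential X relative_to points X))"
    if ?base
  proof (rule ext, rule iffI)
    fix S
    assume "openin (tau X) S"
    then show "(arbitrary union_of (finite intersection_of essential X relative_to points X)) S"
      unfolding that
    proof (rule union_of_mono)
      fix A assume A: "essential X A"
      have "(finite intersection_of essential X relative_to points X) (points X \<inter> A)"
        by (rule relative_to_inc) (rule finite_intersection_of_inc, rule A)
      moreover have "points X \<inter> A = A"
        using openin_subset[OF op[OF A]] by blast
      ultimately show "(finite intersection_of essential X relative_to points X) A"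
        by simp
    qed
  next
    fix S
    assume "(arbitrary union_of (finite intersection_of essential X relative_to points X)) S"
    then show "openin (tau X) S"
      using minimal_topology_subbase[of "essential X" "tau X" "points X" S] op
      by (simp add: openin_subbase)
  qed
  have Inter: "\<forall>\<F>. finite \<F> \<and> \<F> \<noteq> {} \<and> \<F> \<subseteq> Collect (essential X) \<longrightarrow> \<Inter>\<F> \<in> Collect (essential X)"
    if "?latt"
  proof (intro allI impI; elim conjE)
    fix \<F> assume "finite \<F>" "\<F> \<noteq> {}" "\<F> \<subseteq> Collect (essential X)"
    then show "\<Inter>\<F> \<in> Collect (essential X)"
      by (induction \<F> rule: finite_ne_induct) (use that in auto)
  qed
  have "pairwise_BD X \<longleftrightarrow> pairwise_T0 X \<and> ?base \<and> ?latt \<and> ?fin"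
    unfolding pairwise_BD_def dE latt[symmetric] fin[symmetric] Collect_mem_eq mem_Collect_eq
      eq[symmetric]
    by (rule iffI; elim conjE; intro conjI; (rule refl sub Inter[unfolded mem_Collect_eq])?; assumption)
  then show ?thesis
    using eq by (simp add: doubly_BD_def)
qed (simp add: doubly_BD_def)

lemma essential_openin: "doubly_BD X \<Longrightarrow> essential X A \<Longrightarrow> openin (tau X) A"
  using essential_iff[of X A] by (simp add: doubly_BD_def)

lemma essential_Un_Int:
  assumes "doubly_BD X" "essential X A" "essential X B"
  shows "essential X (A \<union> B)" "essential X (A \<inter> B)"
  using assms unfolding doubly_BD_iff by blast+

lemma openin_essential_base:
  "doubly_BD X \<Longrightarrow> openin (tau X) = arbitrary union_of essential X"
  unfolding doubly_BD_iff by blast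

text \<open>Continuity can be tested on the base of essential sets. In the clauses for d and i both
  sides reduce to the preimage of \<open>A\<close>, as \<open>A\<close> and its preimage are
  fixed.\<close>

lemma BD_hom_iff:
  assumes X: "doubly_BD X" and Y: "doubly_BD Y"
  shows "f \<in> BD_hom X Y \<longleftrightarrow> f \<in> points X \<rightarrow>\<^sub>E points Y \<and>
    (\<forall>A. essential Y A \<longrightarrow> essential X (f -` A \<inter> points X))"
proof
  assume *: "f \<in> points X \<rightarrow>\<^sub>E points Y \<and>
    (\<forall>A. essential Y A \<longrightarrow> essential X (f -` A \<inter> points X))"
  have eq: "tau X = sigma X" "tau Y = sigma Y"
    and base: "openin (tau Y) = arbitrary union_of essential Y"
    using X Y openin_essential_base[OF Y] by (auto simp: doubly_BD_def)
  have "continuous_map (tau X) (tau Y) f"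
  proof (rule continuous_map_into_topology_base[OF base])
    show "f x \<in> points Y" if "x \<in> points X" for x
      using * that by auto
    show "openin (tau X) {x \<in> points X. f x \<in> A}" if "essential Y A" for A
    proof -
      have "{x \<in> points X. f x \<in> A} = f -` A \<inter> points X"
        by blast
      then show ?thesis
        using * that essential_openin[OF X] by simp
    qed
  qed
  moreover have "d_op Y A = A" "i_op Y A = A" if "essential Y A" for A
    using d_op_openin[OF eq(2)] i_op_openin essential_openin[OF Y that] by blast+
  moreover have "d_op X A = A" "i_op X A = A" if "essential X A" for A
    using d_op_openin[OF eq(1)] i_op_openin essential_openin[OF X that] by blast+
  ultimately show "f \<in> BD_hom X Y"
    using * eq by (simp add: BD_hom_def)
qed (auto simp: BD_hom_def)

lemma BD_id_in_hom:
  assumes "doubly_BD X"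
  shows "BD_id X \<in> BD_hom X X"
proof -
  have "BD_id X -` A \<inter> points X = A" if "essential X A" for A
    using openin_subset[OF essential_openin[OF assms that]] by (auto simp: BD_id_def)
  then show ?thesis
    unfolding BD_hom_iff[OF assms assms] by (simp add: BD_id_def)
qed

lemma compose_in_BD_hom:
  assumes X: "doubly_BD X" and Y: "doubly_BD Y" and Z: "doubly_BD Z"
    and f: "f \<in> BD_hom X Y" and g: "g \<in> BD_hom Y Z"
  shows "compose (points X) g f \<in> BD_hom X Z"
proof -
  have f': "f \<in> points X \<rightarrow>\<^sub>E points Y" "\<And>A. essential Y A \<Longrightarrow> essential X (f -` A \<inter> points X)"
    and g': "g \<in> points Y \<rightarrow>\<^sub>E points Z" "\<And>A. essential Z A \<Longrightarrow> essential Y (g -` A \<inter> points Y)"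
    using f g by (auto simp: BD_hom_iff[OF X Y] BD_hom_iff[OF Y Z])
  have "compose (points X) g f -` A \<inter> points X = f -` (g -` A \<inter> points Y) \<inter> points X" for A
    using f'(1) by (auto simp: compose_def)
  then have "essential X (compose (points X) g f -` A \<inter> points X)" if "essential Z A" for A
    using f'(2)[OF g'(2)[OF that]] by simp
  then show ?thesis
    unfolding BD_hom_iff[OF X Z] using f'(1) g'(1) by (auto simp: compose_def)
qed

section \<open>The spectrum\<close>

context distributive_lattice
begin

lemma sigma_spec_base:
  "openin (sigma (spec_obj L)) = arbitrary union_of (\<lambda>S. S \<in> delta L ` carrier L)"
proof -
  have "delta L ` carrier L = epsilon L ` carrier L"
    using delta_eq_epsilon by simp
  then show ?thesis
    using openin_sigma_spec_obj[OF lattice_axioms] by simp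
qed

text \<open>The sets \<open>delta L x\<close> are a subbasis of one topology and, being equal to
  \<open>epsilon L x\<close>, a base of the other.\<close>

lemma tau_eq_sigma_spec: "tau (spec_obj L) = sigma (spec_obj L)"
  unfolding topology_eq
proof (intro allI iffI)
  fix S
  assume "openin (tau (spec_obj L)) S"
  then show "openin (sigma (spec_obj L)) S"
    unfolding spec_obj_def bispace.simps
  proof (rule minimal_topology_subbase[rotated 2])
    show "openin (topology (arbitrary union_of (\<lambda>S. S \<in> epsilon L ` carrier L))) T"
      if "T \<in> delta L ` carrier L" for T
      using arbitrary_union_of_inc[of "\<lambda>S. S \<in> delta L ` carrier L", OF that] sigma_spec_base
      by (simp add: spec_obj_def)
    \<comment> \<open>The subbasis is taken relative to the whole spectrum, which therefore must be
      open for \<open>sigma\<close> too; it is, because filters are nonempty.\<close>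
    show "openin (topology (arbitrary union_of (\<lambda>S. S \<in> epsilon L ` carrier L))) (comaximal_pairs L)"
      using topspace_sigma_spec_obj[OF lattice_axioms] openin_topspace[of "sigma (spec_obj L)"]
      by (simp add: spec_obj_def)
  qed
next
  fix S
  assume "openin (sigma (spec_obj L)) S"
  then show "openin (tau (spec_obj L)) S"
    unfolding sigma_spec_base openin_tau_spec_obj
  proof (rule union_of_mono)
    fix A assume A: "A \<in> delta L ` carrier L"
    show "(finite intersection_of (\<lambda>S. S \<in> delta L ` carrier L) relative_to comaximal_pairs L) A"
      by (rule relative_to_subset_inc) (use A in \<open>auto simp: delta_def intro: finite_intersection_of_inc\<close>)
  qed
qed

lemma tau_spec_base:
  "openin (tau (spec_obj L)) = arbitrary union_of (\<lambda>S. S \<in> delta L ` carrier L)"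
  by (simp add: tau_eq_sigma_spec sigma_spec_base)

lemma openin_delta: "x \<in> carrier L \<Longrightarrow> openin (tau (spec_obj L)) (delta L x)"
  unfolding tau_spec_base by (simp add: arbitrary_union_of_inc)

lemma openin_spec_Union:
  assumes "openin (tau (spec_obj L)) U" "p \<in> U"
  shows "\<exists>y\<in>carrier L. p \<in> delta L y \<and> delta L y \<subseteq> U"
  using assms unfolding tau_spec_base union_of_def by blast

lemma compactin_delta:
  assumes x: "x \<in> carrier L"
  shows "compactin (tau (spec_obj L)) (delta L x)"
proof (cases "delta L x = {}")
  case False
  have "\<exists>\<F>. finite \<F> \<and> \<F> \<subseteq> \<U> \<and> delta L x \<subseteq> \<Union>\<F>"
    if op: "\<And>U. U \<in> \<U> \<Longrightarrow> openin (tau (spec_obj L)) U" and cov: "delta L x \<subseteq> \<Union>\<U>" for \<U>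
  proof -
    \<comment> \<open>The cover is refined to basic sets so that \<open>delta_compactness\<close>
      applies; \<open>h\<close> below returns from them to members of the cover. \<open>W\<close> is
      nonempty because \<open>delta L x\<close> is.\<close>
    define W where "W = {D \<in> delta L ` carrier L. \<exists>U\<in>\<U>. D \<subseteq> U}"
    have covW: "\<Inter>{delta L x} \<subseteq> \<Union>W"
    proof
      fix p assume "p \<in> \<Inter>{delta L x}"
      then obtain U where "U \<in> \<U>" "p \<in> U"
        using cov by blast
      then obtain y where "y \<in> carrier L" "p \<in> delta L y" "delta L y \<subseteq> U"
        using openin_spec_Union[OF op] by blast
      then show "p \<in> \<Union>W"
        using \<open>U \<in> \<U>\<close> unfolding W_def by blast
    qed
    moreover have "W \<noteq> {}"
      using covW False by auto
    moreover have "W \<subseteq> delta L ` carrier L"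
      by (auto simp: W_def)
    ultimately obtain V1 W1 where "V1 \<noteq> {}" "V1 \<subseteq> {delta L x}" "finite W1" "W1 \<subseteq> W" "\<Inter>V1 \<subseteq> \<Union>W1"
      using delta_compactness[of "{delta L x}" W] x by auto
    then have W1: "finite W1" "W1 \<subseteq> W" "delta L x \<subseteq> \<Union>W1"
      by (auto simp: subset_singleton_iff)
    have "\<forall>D\<in>W1. \<exists>U\<in>\<U>. D \<subseteq> U"
      using W1(2) by (auto simp: W_def)
    then obtain h where h: "\<And>D. D \<in> W1 \<Longrightarrow> h D \<in> \<U> \<and> D \<subseteq> h D"
      by metis
    then have "delta L x \<subseteq> \<Union>(h ` W1)"
      using W1(3) by fastforce
    then show ?thesis
      using W1(1) h by (intro exI[of _ "h ` W1"]) auto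
  qed
  then show ?thesis
    using delta_subset by (simp add: compactin_def points_spec_obj)
qed simp

text \<open>A compact open set is a finite union of basic sets. Nonemptiness makes the union
  nonempty, as \<open>delta_Union\<close> requires; \<open>{}\<close> itself is a value of
  \<open>delta L\<close> only if there is a least element.\<close>

lemma compact_openin_spec:
  assumes "compactin (tau (spec_obj L)) A" "openin (tau (spec_obj L)) A" "A \<noteq> {}"
  shows "A \<in> delta L ` carrier L"
proof -
  define \<U> where "\<U> = {D \<in> delta L ` carrier L. D \<subseteq> A}"
  have "A \<subseteq> \<Union>\<U>"
  proof
    fix p assume "p \<in> A"
    then obtain y where "y \<in> carrier L" "p \<in> delta L y" "delta L y \<subseteq> A"
      using openin_spec_Union[OF assms(2)] by blast
    then show "p \<in> \<Union>\<U>"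
      by (auto simp: \<U>_def)
  qed
  moreover have "openin (tau (spec_obj L)) D" if "D \<in> \<U>" for D
    using that openin_delta by (auto simp: \<U>_def)
  ultimately obtain \<F> where \<F>: "finite \<F>" "\<F> \<subseteq> \<U>" "A \<subseteq> \<Union>\<F>"
    using compactinD[OF assms(1)] by metis
  then have "A = \<Union>\<F>"
    by (auto simp: \<U>_def)
  moreover have "\<Union>\<F> \<in> delta L ` carrier L"
    using \<F> assms(3) by (intro delta_Union) (auto simp: \<U>_def)
  ultimately show ?thesis
    by simp
qed

text \<open>The right side says that \<open>L\<close> has a least element. Without one, the family
  of all \<open>delta L x\<close> has the finite intersection property, yet a point in all of them
  would have an empty ideal.\<close>

lemma compact_open_fip_spec_iff:
  "compact_open_fip (tau (spec_obj L)) \<longleftrightarrow> {} \<in> delta L ` carrier L"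
proof
  assume fip: "compact_open_fip (tau (spec_obj L))"
  show "{} \<in> delta L ` carrier L"
  proof (rule ccontr)
    assume empty: "{} \<notin> delta L ` carrier L"
    have "points (spec_obj L) \<inter> \<Inter>\<W> \<noteq> {}" if "finite \<W>" "\<W> \<subseteq> delta L ` carrier L" for \<W>
    proof (cases "\<W> = {}")
      case True
      \<comment> \<open>The empty subfamily asks for a point of the spectrum; any
        \<open>delta L x\<close> provides one, since none is empty.\<close>
      then show ?thesis
        using carrier_nonempty empty delta_subset by (force simp: points_spec_obj)
    next
      case False
      then have "\<Inter>\<W> \<in> delta L ` carrier L"
        using delta_Inter that by blast
      then obtain x where "\<Inter>\<W> = delta L x"
        by blast
      moreover have "\<Inter>\<W> \<noteq> {}"
        using empty \<open>\<Inter>\<W> \<in> delta L ` carrier L\<close> by metis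
      ultimately show ?thesis
        using delta_subset[of x] by (auto simp: points_spec_obj)
    qed
    moreover have "compactin (tau (spec_obj L)) C \<and> openin (tau (spec_obj L)) C"
      if "C \<in> delta L ` carrier L" for C
      using that compactin_delta openin_delta by blast
    ultimately have "points (spec_obj L) \<inter> \<Inter>(delta L ` carrier L) \<noteq> {}"
      using fip[unfolded compact_open_fip_def, rule_format, of "delta L ` carrier L"] by blast
    then obtain I F where IF: "(I, F) \<in> comaximal_pairs L" "\<And>x. x \<in> carrier L \<Longrightarrow> x \<notin> I"
      by (auto simp: points_spec_obj delta_def)
    then have "I \<noteq> {}" "I \<subseteq> carrier L"
      by (auto simp: comaximal_pairs_iff lat_ideal_def)
    then show False
      using IF(2) by blast
  qed
next
  assume empty: "{} \<in> delta L ` carrier L"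
  show "compact_open_fip (tau (spec_obj L))"
    unfolding compact_open_fip_def
  proof (intro allI impI; elim conjE)
    fix \<U>
    assume co: "\<forall>C\<in>\<U>. compactin (tau (spec_obj L)) C \<and> openin (tau (spec_obj L)) C"
      and fip: "\<forall>\<W>. finite \<W> \<and> \<W> \<subseteq> \<U> \<longrightarrow> points (spec_obj L) \<inter> \<Inter>\<W> \<noteq> {}"
    show "points (spec_obj L) \<inter> \<Inter>\<U> \<noteq> {}"
    proof (cases "\<U> = {}")
      case True
      then show ?thesis
        using fip by blast
    next
      case False
      have U: "\<U> \<subseteq> delta L ` carrier L"
        using co empty compact_openin_spec by blast
      have "\<Inter>\<U> \<noteq> {}"
      proof
        assume "\<Inter>\<U> = {}"
        \<comment> \<open>\<open>{{}}\<close> is a nonempty family with union \<open>{}\<close>, so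
          here the statement about coverings speaks of empty intersections.\<close>
        then obtain V1 W1 where "finite V1" "V1 \<subseteq> \<U>" "W1 \<subseteq> {{}}" "\<Inter>V1 \<subseteq> \<Union>W1"
          using delta_compactness[OF U False, of "{{}}"] empty by auto
        then have "finite V1" "V1 \<subseteq> \<U>" "\<Inter>V1 = {}"
          by auto
        then show False
          using fip by blast
      qed
      moreover have "\<Inter>\<U> \<subseteq> points (spec_obj L)"
        using False U delta_subset unfolding points_spec_obj by blast
      ultimately show ?thesis
        by blast
    qed
  qed
qed

lemma essential_spec_iff: "essential (spec_obj L) A \<longleftrightarrow> A \<in> delta L ` carrier L"
proof (cases "A = {}")
  case False
  then show ?thesis
    using compactin_delta openin_delta compact_openin_spec
    unfolding essential_iff[OF tau_eq_sigma_spec] by blast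
qed (simp add: essential_iff[OF tau_eq_sigma_spec] compact_open_fip_spec_iff)

lemma pairwise_T0_spec: "pairwise_T0 (spec_obj L)"
  unfolding pairwise_T0_def points_spec_obj
proof (intro ballI impI)
  fix p q assume p: "p \<in> comaximal_pairs L" and q: "q \<in> comaximal_pairs L" and "p \<noteq> q"
  obtain I F J K where pq: "p = (I, F)" "q = (J, K)"
    by fastforce
  \<comment> \<open>A point is determined by its ideal, so some \<open>x\<close> lies in exactly one
    of the two ideals and \<open>delta L x\<close> separates the points.\<close>
  have "F = carrier L - I" "K = carrier L - J" and sub: "I \<subseteq> carrier L" "J \<subseteq> carrier L"
    using p q unfolding pq comaximal_pairs_iff by blast+
  then have "I \<noteq> J"
    using \<open>p \<noteq> q\<close> pq by auto
  then obtain x where "x \<in> carrier L" "x \<in> J \<and> x \<notin> I \<or> x \<in> I \<and> x \<notin> J"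
    using sub by blast
  then have "p \<in> delta L x \<and> q \<notin> delta L x \<or> q \<in> delta L x \<and> p \<notin> delta L x"
    "openin (tau (spec_obj L)) (delta L x)"
    using p q openin_delta by (auto simp: pq mem_delta_iff)
  then show "(\<exists>U. openin (tau (spec_obj L)) U \<and> p \<in> U \<and> q \<notin> U) \<or>
      (\<exists>U. openin (sigma (spec_obj L)) U \<and> q \<in> U \<and> p \<notin> U)"
    using tau_eq_sigma_spec by metis
qed

lemma doubly_BD_spec: "doubly_BD (spec_obj L)"
  unfolding doubly_BD_iff
proof (intro conjI)
  have ess: "essential (spec_obj L) = (\<lambda>A. A \<in> delta L ` carrier L)"
    using essential_spec_iff by (intro ext)
  show "openin (tau (spec_obj L)) = arbitrary union_of essential (spec_obj L)"
    by (simp add: ess tau_spec_base)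
  show "\<forall>A B. essential (spec_obj L) A \<and> essential (spec_obj L) B \<longrightarrow>
      essential (spec_obj L) (A \<union> B) \<and> essential (spec_obj L) (A \<inter> B)"
    unfolding ess using delta_Union[of "{A, B}" for A B] delta_Inter[of "{A, B}" for A B] by auto
  show "\<forall>V W. V \<noteq> {} \<and> W \<noteq> {} \<and> V \<subseteq> Collect (essential (spec_obj L)) \<and>
      W \<subseteq> Collect (essential (spec_obj L)) \<and> \<Inter>V \<subseteq> \<Union>W \<longrightarrow>
      (\<exists>V1 W1. finite V1 \<and> V1 \<noteq> {} \<and> V1 \<subseteq> V \<and> finite W1 \<and> W1 \<noteq> {} \<and> W1 \<subseteq> W \<and> \<Inter>V1 \<subseteq> \<Union>W1)"
    unfolding ess Collect_mem_eq using delta_compactness by blast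
qed (rule tau_eq_sigma_spec pairwise_T0_spec)+

end

text \<open>\<open>x\<close> avoids the preimage of \<open>I\<close> iff \<open>f x\<close> avoids
  \<open>I\<close>. This identity gives both the morphism property of \<open>spec_map\<close> and
  the naturality of \<open>unit_L\<close>.\<close>

lemma spec_map_vimage_delta:
  assumes f: "f \<in> Dp_hom L N" and x: "x \<in> carrier L"
  shows "spec_map L N f -` delta L x \<inter> comaximal_pairs N = delta N (f x)"
  using comaximal_pairs_vimage[OF f] x by (auto simp: spec_map_def delta_def)

lemma spec_map_in_hom:
  assumes L: "distributive_lattice L" and N: "distributive_lattice N" and f: "f \<in> Dp_hom L N"
  shows "spec_map L N f \<in> BD_hom (spec_obj N) (spec_obj L)"
proof -
  interpret L: distributive_lattice L by fact
  interpret N: distributive_lattice N by fact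
  have fc: "f x \<in> carrier N" if "x \<in> carrier L" for x
    using f that by (auto simp: Dp_hom_def)
  have "spec_map L N f \<in> comaximal_pairs N \<rightarrow>\<^sub>E comaximal_pairs L"
    using comaximal_pairs_vimage[OF f] by (auto simp: spec_map_def)
  then show ?thesis
    unfolding BD_hom_iff[OF N.doubly_BD_spec L.doubly_BD_spec] points_spec_obj
      L.essential_spec_iff N.essential_spec_iff
    using spec_map_vimage_delta[OF f] fc by auto
qed

lemma spec_map_id:
  assumes L: "distributive_lattice L"
  shows "spec_map L L (Dp_id L) = BD_id (spec_obj L)"
proof -
  interpret distributive_lattice L by fact
  have "Dp_id L -` A \<inter> carrier L = A" if "A \<subseteq> carrier L" for A
    using that by (auto simp: Dp_id_def)
  moreover have "I \<subseteq> carrier L \<and> F \<subseteq> carrier L" if "(I, F) \<in> comaximal_pairs L" for I F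
    using that by (auto simp: comaximal_pairs_iff)
  ultimately show ?thesis
    unfolding spec_map_def BD_id_def points_spec_obj
    by (intro restrict_ext) (metis (no_types, lifting) case_prod_conv surj_pair)
qed

lemma spec_map_compose:
  assumes f: "f \<in> Dp_hom L M" and g: "g \<in> Dp_hom M N"
  shows "spec_map L N (compose (carrier L) g f) =
    compose (points (spec_obj N)) (spec_map L M f) (spec_map M N g)"
proof
  fix p
  have "compose (carrier L) g f -` A \<inter> carrier L = f -` (g -` A \<inter> carrier M) \<inter> carrier L" for A
    using f by (auto simp: compose_def Dp_hom_def)
  then show "spec_map L N (compose (carrier L) g f) p =
      compose (points (spec_obj N)) (spec_map L M f) (spec_map M N g) p"
    \<comment> \<open>The intermediate pair must be comaximal, as otherwise the restricted function
      \<open>spec_map L M f\<close> would return \<open>undefined\<close> on it.\<close>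
    using comaximal_pairs_vimage[OF g]
    by (cases p) (simp add: spec_map_def points_spec_obj compose_def)
qed


section \<open>The lattice of essential sets\<close>

lemma ess_obj_simps [simp]:
  "carrier (ess_obj X) = Collect (essential X)"
  "le (ess_obj X) = (\<subseteq>)"
  "eq (ess_obj X) = (=)"
  by (simp_all add: ess_obj_def)

lemma lattice_ess_obj:
  assumes "doubly_BD X"
  shows "lattice (ess_obj X)"
proof unfold_locales
  note ess = essential_Un_Int[OF assms]
  fix A B
  assume AB: "A \<in> carrier (ess_obj X)" "B \<in> carrier (ess_obj X)"
  show "\<exists>S. least (ess_obj X) S (Upper (ess_obj X) {A, B})"
    using AB ess by (intro exI[of _ "A \<union> B"]) (auto simp: least_def Upper_def)
  show "\<exists>S. greatest (ess_obj X) S (Lower (ess_obj X) {A, B})"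
    using AB ess by (intro exI[of _ "A \<inter> B"]) (auto simp: greatest_def Lower_def)
qed auto

lemma ess_obj_join_meet:
  assumes X: "doubly_BD X" and A: "essential X A" and B: "essential X B"
  shows "A \<squnion>\<^bsub>ess_obj X\<^esub> B = A \<union> B" "A \<sqinter>\<^bsub>ess_obj X\<^esub> B = A \<inter> B"
proof -
  interpret lattice "ess_obj X"
    by (rule lattice_ess_obj[OF X])
  show "A \<squnion>\<^bsub>ess_obj X\<^esub> B = A \<union> B" "A \<sqinter>\<^bsub>ess_obj X\<^esub> B = A \<inter> B"
    using A B essential_Un_Int[OF X A B] join_left[of A B] join_right[of A B] join_le[of A "A \<union> B" B]
      meet_left[of A B] meet_right[of A B] meet_le[of "A \<inter> B" A B] by auto
qed

lemma essential_cover: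
  assumes "doubly_BD X" "x \<in> points X"
  shows "\<exists>A. essential X A \<and> x \<in> A"
proof -
  have "(arbitrary union_of essential X) (points X)"
    using openin_topspace[of "tau X"] unfolding openin_essential_base[OF assms(1)] .
  then show ?thesis
    using assms(2) unfolding union_of_def by blast
qed

text \<open>This makes the ideal attached to a point nonempty. If all essential sets contained
  \<open>x\<close>, so would all nonempty compact open sets; then \<open>x\<close> would lie in the
  intersection of every family with the finite intersection property, and \<open>{}\<close> would be
  an essential set avoiding \<open>x\<close>.\<close>

lemma essential_avoid:
  assumes X: "doubly_BD X" and x: "x \<in> points X"
  shows "\<exists>A. essential X A \<and> x \<notin> A"
proof (rule ccontr)
  assume "\<nexists>A. essential X A \<and> x \<notin> A"
  then have all: "x \<in> A" if "essential X A" for A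
    using that by blast
  have eq: "tau X = sigma X"
    using X by (simp add: doubly_BD_def)
  have "compact_open_fip (tau X)"
    unfolding compact_open_fip_def
  proof (intro allI impI; elim conjE)
    fix \<U>
    assume co: "\<forall>C\<in>\<U>. compactin (tau X) C \<and> openin (tau X) C"
      and fip: "\<forall>\<W>. finite \<W> \<and> \<W> \<subseteq> \<U> \<longrightarrow> points X \<inter> \<Inter>\<W> \<noteq> {}"
    have "x \<in> C" if "C \<in> \<U>" for C
    proof -
      have "C \<noteq> {}"
        using fip[rule_format, of "{C}"] that by auto
      then show ?thesis
        using all co that essential_iff[OF eq] by blast
    qed
    then show "points X \<inter> \<Inter>\<U> \<noteq> {}"
      using x by blast
  qed
  then have "essential X {}"
    by (simp add: essential_iff[OF eq])
  then show False
    using all by blast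
qed

lemma distributive_lattice_ess_obj:
  assumes X: "doubly_BD X"
  shows "distributive_lattice (ess_obj X)"
proof -
  interpret lattice "ess_obj X"
    by (rule lattice_ess_obj[OF X])
  show ?thesis
  proof unfold_locales
    show "carrier (ess_obj X) \<noteq> {}"
    proof (cases "points X = {}")
      case True
      \<comment> \<open>In the empty space already the empty subfamily violates the finite
        intersection property, so the condition holds vacuously.\<close>
      then have "compact_open_fip (tau X)"
        unfolding compact_open_fip_def by blast
      then have "essential X {}"
        using essential_iff[of X "{}"] X by (simp add: doubly_BD_def)
      then show ?thesis
        by auto
    next
      case False
      then show ?thesis
        using essential_cover[OF X] unfolding ess_obj_simps by blast
    qed
    fix A B C
    assume "A \<in> carrier (ess_obj X)" "B \<in> carrier (ess_obj X)" "C \<in> carrier (ess_obj X)"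
    then show "A \<sqinter>\<^bsub>ess_obj X\<^esub> (B \<squnion>\<^bsub>ess_obj X\<^esub> C) =
        (A \<sqinter>\<^bsub>ess_obj X\<^esub> B) \<squnion>\<^bsub>ess_obj X\<^esub> (A \<sqinter>\<^bsub>ess_obj X\<^esub> C)"
      by (simp add: ess_obj_join_meet[OF X] essential_Un_Int[OF X] Int_Un_distrib)
  qed
qed

section \<open>Points of a space as comaximal pairs\<close>

lemma unit_X_apply:
  assumes X: "doubly_BD X" and x: "x \<in> points X"
  shows "unit_X X x = ({A. essential X A \<and> x \<notin> A}, {A. essential X A \<and> x \<in> A})"
proof -
  have "d_op X A = A" if "essential X A" for A
    using X by (intro d_op_openin essential_openin[OF X that]) (simp add: doubly_BD_def)
  then show ?thesis
    using x by (auto simp: unit_X_def)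
qed

lemma unit_X_comaximal:
  assumes X: "doubly_BD X" and x: "x \<in> points X"
  shows "unit_X X x \<in> comaximal_pairs (ess_obj X)"
proof -
  interpret distributive_lattice "ess_obj X"
    by (rule distributive_lattice_ess_obj[OF X])
  note ess = essential_Un_Int[OF X]
  show ?thesis
    unfolding unit_X_apply[OF X x] comaximal_pairs_iff lat_ideal_def lat_filter_def
    using essential_cover[OF X x] essential_avoid[OF X x]
    by (auto simp: ess_obj_join_meet[OF X] ess)
qed

lemma bij_betw_unit_X:
  assumes X: "doubly_BD X"
  shows "bij_betw (unit_X X) (points X) (comaximal_pairs (ess_obj X))"
  unfolding bij_betw_def
proof
  show "inj_on (unit_X X) (points X)"
  proof (rule inj_onI, rule ccontr)
    fix x y assume x: "x \<in> points X" and y: "y \<in> points X" and "x \<noteq> y"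
      and eq: "unit_X X x = unit_X X y"
    have ts: "tau X = sigma X" and T0: "pairwise_T0 X"
      using X by (simp_all add: doubly_BD_def pairwise_BD_def)
    note base = openin_essential_base[OF X]
    \<comment> \<open>Equal images mean equal membership in all essential sets, hence in all open
      sets, as these are unions of essential ones.\<close>
    have same: "x \<in> A \<longleftrightarrow> y \<in> A" if "essential X A" for A
      using eq that unfolding unit_X_apply[OF X x] unit_X_apply[OF X y] by blast
    have "x \<in> U \<longleftrightarrow> y \<in> U" if "openin (tau X) U" for U
      using that same unfolding base union_of_def by blast
    then show False
      using T0 x y \<open>x \<noteq> y\<close> ts unfolding pairwise_T0_def by metis
  qed
next
  interpret distributive_lattice "ess_obj X"
    by (rule distributive_lattice_ess_obj[OF X])
  have "p \<in> unit_X X ` points X" if "p \<in> comaximal_pairs (ess_obj X)" for p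
  proof -
    obtain I F where p: "p = (I, F)"
      by fastforce
    have I: "lat_ideal (ess_obj X) I" and F: "lat_filter (ess_obj X) F"
      and disj: "I \<inter> F = {}" and cov: "I \<union> F = Collect (essential X)"
      using that by (auto simp: p comaximal_pairs_iff)
    have ne: "I \<noteq> {}" "F \<noteq> {}"
      using I F by (auto simp: lat_ideal_def lat_filter_def)
    have ess: "essential X A" if "A \<in> I \<union> F" for A
      using that cov by blast
    have UnI: "\<Union>W \<in> I" if "finite W" "W \<noteq> {}" "W \<subseteq> I" for W
      using that
    proof (induction rule: finite_ne_induct)
      case (insert A W)
      then have "A \<squnion>\<^bsub>ess_obj X\<^esub> \<Union>W \<in> I"
        using I by (simp add: lat_ideal_def)
      then show ?case
        using insert ess by (simp add: ess_obj_join_meet[OF X])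
    qed auto
    have IntF: "\<Inter>V \<in> F" if "finite V" "V \<noteq> {}" "V \<subseteq> F" for V
      using that
    proof (induction rule: finite_ne_induct)
      case (insert A V)
      then have "A \<sqinter>\<^bsub>ess_obj X\<^esub> \<Inter>V \<in> F"
        using F by (simp add: lat_filter_def)
      then show ?case
        using insert ess by (simp add: ess_obj_join_meet[OF X])
    qed auto
    \<comment> \<open>Condition (v) would give finite \<open>V\<close> and \<open>W\<close> with the
      element \<open>\<Inter>V\<close> of \<open>F\<close> below the element
      \<open>\<Union>W\<close> of \<open>I\<close>, against disjointness.\<close>
    have "\<not> \<Inter>F \<subseteq> \<Union>I"
    proof
      assume "\<Inter>F \<subseteq> \<Union>I"
      moreover have "F \<subseteq> Collect (essential X)" "I \<subseteq> Collect (essential X)"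
        using cov by auto
      ultimately obtain V W where V: "finite V" "V \<noteq> {}" "V \<subseteq> F"
        and W: "finite W" "W \<noteq> {}" "W \<subseteq> I" and sub: "\<Inter>V \<subseteq> \<Union>W"
        using X ne unfolding doubly_BD_iff by meson
      have "\<Inter>V \<in> I"
        using ideal_down[OF I UnI[OF W], of "\<Inter>V"] sub IntF[OF V] ess by simp
      then show False
        using IntF[OF V] disj by blast
    qed
    then obtain x where x: "x \<in> \<Inter>F" "x \<notin> \<Union>I"
      by blast
    obtain A where "A \<in> F"
      using ne by blast
    then have "x \<in> points X"
      using x openin_subset[OF essential_openin[OF X ess[of A]]] by blast
    \<comment> \<open>\<open>I\<close> and \<open>F\<close> partition the essential sets, so a point
      in all of \<open>F\<close> and in none of \<open>I\<close> determines both.\<close>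
    moreover have "I = {A. essential X A \<and> x \<notin> A}" "F = {A. essential X A \<and> x \<in> A}"
      using x cov by blast+
    ultimately have "unit_X X x = p" "x \<in> points X"
      using unit_X_apply[OF X, of x] p by simp_all
    then show ?thesis
      by blast
  qed
  then show "unit_X X ` points X = comaximal_pairs (ess_obj X)"
    using unit_X_comaximal[OF X] by blast
qed

lemma vimage_unit_X_delta:
  assumes X: "doubly_BD X" and A: "essential X A"
  shows "unit_X X -` delta (ess_obj X) A \<inter> points X = A"
proof -
  have "A \<subseteq> points X"
    using openin_subset[OF essential_openin[OF X A]] .
  moreover have "unit_X X x \<in> delta (ess_obj X) A \<longleftrightarrow> x \<in> A" if "x \<in> points X" for x
    using unit_X_comaximal[OF X that] A by (simp add: unit_X_apply[OF X that] delta_def)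
  ultimately show ?thesis
    by blast
qed

text \<open>The preimage of \<open>A\<close> contains \<open>x\<close> iff \<open>A\<close> contains
  \<open>f x\<close>, so pulling back the pair of \<open>x\<close> gives the pair of
  \<open>f x\<close>. Used for quasi-properness of \<open>ess_map\<close> and for naturality of
  \<open>unit_X\<close>.\<close>

lemma ess_map_vimage_unit_X:
  assumes X: "doubly_BD X" and Y: "doubly_BD Y" and f: "f \<in> BD_hom X Y" and x: "x \<in> points X"
    and IF: "unit_X X x = (I, F)"
  shows "(ess_map X Y f -` I \<inter> carrier (ess_obj Y), ess_map X Y f -` F \<inter> carrier (ess_obj Y)) =
    unit_X Y (f x)"
proof -
  have "f x \<in> points Y" and ess: "\<And>A. essential Y A \<Longrightarrow> essential X (f -` A \<inter> points X)"
    using f x by (auto simp: BD_hom_iff[OF X Y])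
  then show ?thesis
    using IF x by (auto simp: unit_X_apply X Y ess_map_def)
qed

lemma ess_map_in_hom:
  assumes X: "doubly_BD X" and Y: "doubly_BD Y" and f: "f \<in> BD_hom X Y"
  shows "ess_map X Y f \<in> Dp_hom (ess_obj Y) (ess_obj X)"
proof -
  have fc: "\<And>x. x \<in> points X \<Longrightarrow> f x \<in> points Y"
    and ess: "\<And>A. essential Y A \<Longrightarrow> essential X (f -` A \<inter> points X)"
    using f by (auto simp: BD_hom_iff[OF X Y])
  have "lat_hom (ess_obj Y) (ess_obj X) (ess_map X Y f)"
    using ess by (auto simp: lat_hom_def ess_map_def ess_obj_join_meet[OF X] ess_obj_join_meet[OF Y]
        essential_Un_Int[OF Y])
  moreover have "quasi_proper (ess_obj Y) (ess_obj X) (ess_map X Y f)"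
    unfolding quasi_proper_def
  proof clarify
    \<comment> \<open>Surjectivity of the unit turns an arbitrary pair into the pair of a point, so
      nonemptiness of its preimages comes with the point \<open>f x\<close>.\<close>
    fix I F assume "(I, F) \<in> comaximal_pairs (ess_obj X)"
    then obtain x where x: "x \<in> points X" and IF: "unit_X X x = (I, F)"
      using bij_betw_unit_X[OF X] by (metis bij_betw_imp_surj_on imageE)
    show "(ess_map X Y f -` I \<inter> carrier (ess_obj Y), ess_map X Y f -` F \<inter> carrier (ess_obj Y))
        \<in> comaximal_pairs (ess_obj Y)"
      unfolding ess_map_vimage_unit_X[OF X Y f x IF] by (rule unit_X_comaximal[OF Y fc[OF x]])
  qed
  ultimately show ?thesis
    using ess by (auto simp: Dp_hom_def ess_map_def)
qed

lemma ess_map_id: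
  assumes X: "doubly_BD X"
  shows "ess_map X X (BD_id X) = Dp_id (ess_obj X)"
proof -
  have "BD_id X -` A \<inter> points X = A" if "essential X A" for A
    using openin_subset[OF essential_openin[OF X that]] by (auto simp: BD_id_def)
  then show ?thesis
    unfolding ess_map_def Dp_id_def ess_obj_simps by (intro restrict_ext) simp
qed

lemma ess_map_compose:
  assumes X: "doubly_BD X" and Y: "doubly_BD Y" and Z: "doubly_BD Z"
    and f: "f \<in> BD_hom X Y" and g: "g \<in> BD_hom Y Z"
  shows "ess_map X Z (compose (points X) g f) =
    compose (carrier (ess_obj Z)) (ess_map X Y f) (ess_map Y Z g)"
proof
  fix A
  have "compose (points X) g f -` A \<inter> points X = f -` (g -` A \<inter> points Y) \<inter> points X"
    using f by (auto simp: compose_def BD_hom_def)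
  moreover have "essential Z A \<Longrightarrow> essential Y (g -` A \<inter> points Y)"
    using g by (simp add: BD_hom_iff[OF Y Z])
  ultimately show "ess_map X Z (compose (points X) g f) A =
      compose (carrier (ess_obj Z)) (ess_map X Y f) (ess_map Y Z g) A"
    by (simp add: ess_map_def compose_def)
qed


section \<open>The natural isomorphisms\<close>

lemma Dp_isoI:
  assumes L: "distributive_lattice L" and N: "distributive_lattice N" and f: "lat_hom L N f"
    and bij: "bij_betw f (carrier L) (carrier N)" and ext: "f \<in> extensional (carrier L)"
  shows "Dp_iso L N f"
proof -
  interpret L: distributive_lattice L by fact
  interpret N: distributive_lattice N by fact
  define g where "g = restrict (inv_into (carrier L) f) (carrier N)"
  have gf: "g (f x) = x" if "x \<in> carrier L" for x
    using that bij by (simp add: g_def bij_betw_inv_into_left bij_betw_apply)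
  have fg: "f (g y) = y" if "y \<in> carrier N" for y
    using that bij by (simp add: g_def bij_betw_inv_into_right)
  have fc: "f x \<in> carrier N" if "x \<in> carrier L" for x
    using that bij by (rule bij_betw_apply[rotated])
  have gc: "g y \<in> carrier L" if "y \<in> carrier N" for y
    using that bij_betw_apply[OF bij_betw_inv_into[OF bij]] by (simp add: g_def)
  have fhom: "f (x \<squnion>\<^bsub>L\<^esub> y) = f x \<squnion>\<^bsub>N\<^esub> f y" "f (x \<sqinter>\<^bsub>L\<^esub> y) = f x \<sqinter>\<^bsub>N\<^esub> f y"
    if "x \<in> carrier L" "y \<in> carrier L" for x y
    using f that by (auto simp: lat_hom_def)
  \<comment> \<open>\<open>f\<close> sends the join of \<open>g a\<close> and \<open>g b\<close> to
    that of \<open>a\<close> and \<open>b\<close>; applying \<open>g\<close> gives the claim, and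
    likewise for meets.\<close>
  have "g (a \<squnion>\<^bsub>N\<^esub> b) = g a \<squnion>\<^bsub>L\<^esub> g b" "g (a \<sqinter>\<^bsub>N\<^esub> b) = g a \<sqinter>\<^bsub>L\<^esub> g b"
    if ab: "a \<in> carrier N" "b \<in> carrier N" for a b
    using ab gf[of "g a \<squnion>\<^bsub>L\<^esub> g b"] gf[of "g a \<sqinter>\<^bsub>L\<^esub> g b"] fhom[of "g a" "g b"] fg gc by simp_all
  then have g: "lat_hom N L g"
    using gc by (simp add: lat_hom_def)
  have "f ` carrier L = carrier N"
    using bij by (simp add: bij_betw_def)
  moreover have "g ` carrier N = carrier L"
  proof
    show "carrier L \<subseteq> g ` carrier N"
      using gf fc by (metis image_eqI subsetI)
  qed (use gc in blast)
  ultimately have "f \<in> Dp_hom L N" "g \<in> Dp_hom N L"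
    using quasi_proper_if_surj[OF L N f] quasi_proper_if_surj[OF N L g] f g fc gc ext
    by (auto simp: Dp_hom_def PiE_def g_def)
  moreover have "compose (carrier L) g f = Dp_id L" "compose (carrier N) f g = Dp_id N"
    using gf fg by (auto simp: compose_def Dp_id_def)
  ultimately show ?thesis
    unfolding Dp_iso_def by blast
qed

lemma Dp_iso_unit_L:
  assumes L: "distributive_lattice L"
  shows "Dp_iso L (ess_obj (spec_obj L)) (unit_L L)"
proof (rule Dp_isoI[OF L])
  interpret distributive_lattice L by fact
  show "distributive_lattice (ess_obj (spec_obj L))"
    by (rule distributive_lattice_ess_obj[OF doubly_BD_spec])
  have ess: "essential (spec_obj L) (delta L x)" if "x \<in> carrier L" for x
    using that by (simp add: essential_spec_iff)
  show "lat_hom L (ess_obj (spec_obj L)) (unit_L L)"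
    using ess by (simp add: lat_hom_def unit_L_def ess_obj_join_meet[OF doubly_BD_spec]
        delta_join delta_meet)
  have "Collect (essential (spec_obj L)) = delta L ` carrier L"
    using essential_spec_iff by blast
  then show "bij_betw (unit_L L) (carrier L) (carrier (ess_obj (spec_obj L)))"
    using inj_on_delta by (simp add: bij_betw_def unit_L_def)
qed (simp add: unit_L_def)

lemma unit_L_natural:
  assumes L: "distributive_lattice L" and N: "distributive_lattice N" and f: "f \<in> Dp_hom L N"
  shows "compose (carrier L) (ess_map (spec_obj N) (spec_obj L) (spec_map L N f)) (unit_L L) =
    compose (carrier L) (unit_L N) f"
proof -
  interpret distributive_lattice L by fact
  show ?thesis
    using f by (auto simp: compose_def fun_eq_iff unit_L_def ess_map_def essential_spec_iff
        points_spec_obj spec_map_vimage_delta Dp_hom_def)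
qed

text \<open>The preimage under the inverse of a bijection is the image, so \<open>img\<close> is the
  morphism condition for the inverse.\<close>

lemma BD_isoI:
  assumes X: "doubly_BD X" and Y: "doubly_BD Y"
    and bij: "bij_betw f (points X) (points Y)" and ext: "f \<in> extensional (points X)"
    and pre: "\<And>B. essential Y B \<Longrightarrow> essential X (f -` B \<inter> points X)"
    and img: "\<And>A. essential X A \<Longrightarrow> essential Y (f ` A)"
  shows "BD_iso X Y f"
proof -
  define g where "g = restrict (inv_into (points X) f) (points Y)"
  have gf: "g (f x) = x" if "x \<in> points X" for x
    using that bij by (simp add: g_def bij_betw_inv_into_left bij_betw_apply)
  have fg: "f (g y) = y" if "y \<in> points Y" for y
    using that bij by (simp add: g_def bij_betw_inv_into_right)
  have fc: "f x \<in> points Y" if "x \<in> points X" for x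
    using that bij by (rule bij_betw_apply[rotated])
  have gc: "g y \<in> points X" if "y \<in> points Y" for y
    using that bij_betw_apply[OF bij_betw_inv_into[OF bij]] by (simp add: g_def)
  have "g -` A \<inter> points Y = f ` A" if "essential X A" for A
  proof -
    have "A \<subseteq> points X"
      using openin_subset[OF essential_openin[OF X that]] .
    then show ?thesis
      using fc fg gf by (force simp: image_iff)
  qed
  then have "f \<in> BD_hom X Y" "g \<in> BD_hom Y X"
    unfolding BD_hom_iff[OF X Y] BD_hom_iff[OF Y X]
    using fc gc ext pre img by (auto simp: PiE_def g_def)
  moreover have "compose (points X) g f = BD_id X" "compose (points Y) f g = BD_id Y"
    using gf fg by (auto simp: compose_def BD_id_def)
  ultimately show ?thesis
    unfolding BD_iso_def by blast
qed

lemma BD_iso_unit_X: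
  assumes X: "doubly_BD X"
  shows "BD_iso X (spec_obj (ess_obj X)) (unit_X X)"
proof -
  interpret distributive_lattice "ess_obj X"
    by (rule distributive_lattice_ess_obj[OF X])
  have bij: "bij_betw (unit_X X) (points X) (points (spec_obj (ess_obj X)))"
    unfolding points_spec_obj by (rule bij_betw_unit_X[OF X])
  show ?thesis
  proof (rule BD_isoI[OF X doubly_BD_spec bij])
    show "essential X (unit_X X -` B \<inter> points X)" if "essential (spec_obj (ess_obj X)) B" for B
      using that vimage_unit_X_delta[OF X] by (auto simp: essential_spec_iff)
    show "essential (spec_obj (ess_obj X)) (unit_X X ` A)" if A: "essential X A" for A
    proof -
      \<comment> \<open>Surjectivity turns the formula for preimages of basic sets into one for
        images of essential sets.\<close>
      have "delta (ess_obj X) A \<subseteq> unit_X X ` points X"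
        using delta_subset bij_betw_imp_surj_on[OF bij_betw_unit_X[OF X]] by simp
      then have "delta (ess_obj X) A = unit_X X ` (unit_X X -` delta (ess_obj X) A \<inter> points X)"
        by blast
      then have "unit_X X ` A = delta (ess_obj X) A"
        using vimage_unit_X_delta[OF X A] by simp
      then show ?thesis
        using A by (simp add: essential_spec_iff)
    qed
  qed (simp add: unit_X_def)
qed

lemma unit_X_natural:
  assumes X: "doubly_BD X" and Y: "doubly_BD Y" and f: "f \<in> BD_hom X Y"
  shows "compose (points X) (spec_map (ess_obj Y) (ess_obj X) (ess_map X Y f)) (unit_X X) =
    compose (points X) (unit_X Y) f"
proof -
  have "spec_map (ess_obj Y) (ess_obj X) (ess_map X Y f) (unit_X X x) = unit_X Y (f x)"
    if x: "x \<in> points X" for x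
  proof -
    obtain I F where IF: "unit_X X x = (I, F)"
      by fastforce
    then show ?thesis
      using ess_map_vimage_unit_X[OF X Y f x IF] unit_X_comaximal[OF X x]
      by (simp add: spec_map_def)
  qed
  then show ?thesis
    by (auto simp: compose_def)
qed


section \<open>The duality\<close>

text \<open>Natural isomorphisms for both composites make the functors quasi-inverse, so fullness
  and faithfulness follow without a separate argument.\<close>

theorem mainTheorem2:
  shows
  "\<comment> \<open>both categories: identities and composites of morphisms are morphisms\<close>
   (\<forall>L :: 'a gorder. distrib_lattice_obj L \<longrightarrow> Dp_id L \<in> Dp_hom L L) \<and>
   (\<forall>(L :: 'a gorder) (M :: 'b gorder) (N :: 'c gorder) f g.
      distrib_lattice_obj L \<and> distrib_lattice_obj M \<and> distrib_lattice_obj N \<and>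
      f \<in> Dp_hom L M \<and> g \<in> Dp_hom M N \<longrightarrow> compose (carrier L) g f \<in> Dp_hom L N) \<and>
   (\<forall>X :: 'x bispace. doubly_BD X \<longrightarrow> BD_id X \<in> BD_hom X X) \<and>
   (\<forall>(X :: 'x bispace) (Y :: 'y bispace) (Z :: 'z bispace) f g.
      doubly_BD X \<and> doubly_BD Y \<and> doubly_BD Z \<and>
      f \<in> BD_hom X Y \<and> g \<in> BD_hom Y Z \<longrightarrow> compose (points X) g f \<in> BD_hom X Z) \<and>
   \<comment> \<open>spec is a contravariant functor from distributive lattices to doubly BD spaces\<close>
   (\<forall>L :: 'a gorder. distrib_lattice_obj L \<longrightarrow> doubly_BD (spec_obj L)) \<and>
   (\<forall>(L :: 'a gorder) (N :: 'b gorder) f.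
      distrib_lattice_obj L \<and> distrib_lattice_obj N \<and> f \<in> Dp_hom L N
      \<longrightarrow> spec_map L N f \<in> BD_hom (spec_obj N) (spec_obj L)) \<and>
   (\<forall>L :: 'a gorder. distrib_lattice_obj L
      \<longrightarrow> spec_map L L (Dp_id L) = BD_id (spec_obj L)) \<and>
   (\<forall>(L :: 'a gorder) (M :: 'b gorder) (N :: 'c gorder) f g.
      distrib_lattice_obj L \<and> distrib_lattice_obj M \<and> distrib_lattice_obj N \<and>
      f \<in> Dp_hom L M \<and> g \<in> Dp_hom M N
      \<longrightarrow> spec_map L N (compose (carrier L) g f)
          = compose (points (spec_obj N)) (spec_map L M f) (spec_map M N g)) \<and>
   \<comment> \<open>the essential-set functor is a contravariant functor in the other direction\<close>
   (\<forall>X :: 'x bispace. doubly_BD X \<longrightarrow> distrib_lattice_obj (ess_obj X)) \<and>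
   (\<forall>(X :: 'x bispace) (Y :: 'y bispace) f.
      doubly_BD X \<and> doubly_BD Y \<and> f \<in> BD_hom X Y
      \<longrightarrow> ess_map X Y f \<in> Dp_hom (ess_obj Y) (ess_obj X)) \<and>
   (\<forall>X :: 'x bispace. doubly_BD X \<longrightarrow> ess_map X X (BD_id X) = Dp_id (ess_obj X)) \<and>
   (\<forall>(X :: 'x bispace) (Y :: 'y bispace) (Z :: 'z bispace) f g.
      doubly_BD X \<and> doubly_BD Y \<and> doubly_BD Z \<and> f \<in> BD_hom X Y \<and> g \<in> BD_hom Y Z
      \<longrightarrow> ess_map X Z (compose (points X) g f)
          = compose (carrier (ess_obj Z)) (ess_map X Y f) (ess_map Y Z g)) \<and>
   \<comment> \<open>natural isomorphism from the identity to (ess o spec)\<close>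
   (\<forall>L :: 'a gorder. distrib_lattice_obj L \<longrightarrow> Dp_iso L (ess_obj (spec_obj L)) (unit_L L)) \<and>
   (\<forall>(L :: 'a gorder) (N :: 'b gorder) f.
      distrib_lattice_obj L \<and> distrib_lattice_obj N \<and> f \<in> Dp_hom L N
      \<longrightarrow> compose (carrier L) (ess_map (spec_obj N) (spec_obj L) (spec_map L N f)) (unit_L L)
          = compose (carrier L) (unit_L N) f) \<and>
   \<comment> \<open>natural isomorphism from the identity to (spec o ess)\<close>
   (\<forall>X :: 'x bispace. doubly_BD X \<longrightarrow> BD_iso X (spec_obj (ess_obj X)) (unit_X X)) \<and>
   (\<forall>(X :: 'x bispace) (Y :: 'y bispace) f.
      doubly_BD X \<and> doubly_BD Y \<and> f \<in> BD_hom X Y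
      \<longrightarrow> compose (points X) (spec_map (ess_obj Y) (ess_obj X) (ess_map X Y f)) (unit_X X)
          = compose (points X) (unit_X Y) f)"
  unfolding distrib_lattice_obj_iff
  by (intro conjI allI impI; (elim conjE)?;
      rule Dp_id_in_hom compose_in_Dp_hom BD_id_in_hom compose_in_BD_hom
        distributive_lattice.doubly_BD_spec spec_map_in_hom spec_map_id spec_map_compose
        distributive_lattice_ess_obj ess_map_in_hom ess_map_id ess_map_compose
        Dp_iso_unit_L unit_L_natural BD_iso_unit_X unit_X_natural; assumption)

end
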